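(* Let $\lambda$ be a partition of $n$ with exactly $k$ parts of size $1$. Then $A^{\mathrm{maj},\mathrm{des},\mathrm{exc}}_{\lambda}(q,p,q^{-1}t)$ is $t$-symmetric with center of symmetry $\frac{n-k}{2}$.
   Context: For $n\ge 1$ let $\mathfrak S_n$ be the symmetric group on $[n]=\{1,\dots,n\}$, and write $\sigma=\sigma_1\cdots\sigma_n$ with $\sigma_i=\sigma(i)$. Put $\mathrm{DES}(\sigma)=\{i\in[n-1]:\sigma_i>\sigma_{i+1}\}$, $\mathrm{des}(\sigma)=|\mathrm{DES}(\sigma)|$, $\mathrm{maj}(\sigma)=\sum_{i\in \mathrm{DES}(\sigma)} i$, $\mathrm{exc}(\sigma)=|\{i\in[n-1]:\sigma_i>i\}|$, and let $\lambda(\sigma)$ be the cycle type of $\sigma$. For $\lambda\vdash n$, $$A^{\mathrm{maj},\mathrm{des},\mathrm{exc}}_{\lambda}(q,p,t) = \sum_{\sigma\in\mathfrak S_n,\ \lambda(\sigma)=\lambda} q^{\mathrm{maj}(\sigma)}p^{\mathrm{des}(\sigma)}t^{\mathrm{exc}(\sigma)}.$$ A nonzero polynomial $f(t)=f_rt^r+f_{r+1}t^{r+1}+\cdots+f_st^s$ is $t$-symmetric with center of symmetry $\frac{s+r}{2}$ if $f_{r+i}=f_{s-i}$ for all $i=0,\dots,s-r$; here the coefficients $f_i$ are polynomials in $q$ and $p$. *)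

theory Defs
  imports
    Complex_Main
    "HOL-Library.Multiset"
    "HOL-Combinatorics.Permutations"
    "HOL-Combinatorics.Orbits"
    "HOL-Computational_Algebra.Polynomial_Factorial"
begin

definition is_partition :: "nat \<Rightarrow> nat multiset \<Rightarrow> bool" where
  "is_partition n lam \<longleftrightarrow> 0 \<notin># lam \<and> \<Sum>\<^sub># lam = n"

text \<open>The statistics below take \<open>n\<close> as an argument because an element of the symmetric group
  on \<open>{1..n}\<close> is represented by a function on all of \<open>nat\<close> that \<open>permutes {1..n}\<close>.\<close>

definition DES :: "nat \<Rightarrow> (nat \<Rightarrow> nat) \<Rightarrow> nat set" where
  "DES n \<sigma> = {i \<in> {1..<n}. \<sigma> i > \<sigma> (i + 1)}"

definition des :: "nat \<Rightarrow> (nat \<Rightarrow> nat) \<Rightarrow> nat" where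
  "des n \<sigma> = card (DES n \<sigma>)"

definition maj :: "nat \<Rightarrow> (nat \<Rightarrow> nat) \<Rightarrow> nat" where
  "maj n \<sigma> = \<Sum> (DES n \<sigma>)"

definition exc :: "nat \<Rightarrow> (nat \<Rightarrow> nat) \<Rightarrow> nat" where
  "exc n \<sigma> = card {i \<in> {1..<n}. \<sigma> i > i}"

text \<open>The cycles of \<open>\<sigma>\<close>, fixed points included, are its orbits on \<open>{1..n}\<close>; each orbit is
  counted once.\<close>

definition cycle_type :: "nat \<Rightarrow> (nat \<Rightarrow> nat) \<Rightarrow> nat multiset" where
  "cycle_type n \<sigma> = image_mset card (mset_set (orbit \<sigma> ` {1..n}))"

text \<open>A polynomial with coefficients in \<open>\<nat>\<close>, given through its values in an arbitrary commutative
  semiring; the polynomial itself is the value at indeterminates.\<close>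

definition A_poly ::
  "nat \<Rightarrow> nat multiset \<Rightarrow> 'a \<Rightarrow> 'a \<Rightarrow> 'a \<Rightarrow> 'a :: comm_semiring_1" where
  "A_poly n lam q p t =
    (\<Sum>\<sigma> | \<sigma> permutes {1..n} \<and> cycle_type n \<sigma> = lam. q ^ maj n \<sigma> * p ^ des n \<sigma> * t ^ exc n \<sigma>)"

text \<open>The ring \<open>\<int>[q,p]\<close> is \<open>int poly poly\<close>, with \<open>q\<close> the inner and \<open>p\<close> the outer
  indeterminate. The element \<open>q\<^sup>-\<^sup>1\<close> lives in its fraction field \<open>\<rat>(q,p)\<close>, so that
  \<open>A(q, p, q\<^sup>-\<^sup>1 t)\<close> is an element of \<open>\<rat>(q,p)[t]\<close>.\<close>

definition q_ind :: "int poly poly" where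
  "q_ind = [:[:0, 1:]:]"

definition p_ind :: "int poly poly" where
  "p_ind = [:0, 1:]"

definition A_poly_shifted :: "nat \<Rightarrow> nat multiset \<Rightarrow> int poly poly fract poly" where
  "A_poly_shifted n lam =
    (let q = to_fract q_ind; p = to_fract p_ind
     in A_poly n lam [:q:] [:p:] ([:inverse q:] * [:0, 1:]))"

text \<open>The polynomial is written from its lowest term \<open>r\<close> to its highest term \<open>s\<close>, so the two end
  coefficients are nonzero. Then \<open>r\<close> and \<open>s\<close>, and with them the center, are unique.\<close>

definition t_symmetric :: "'a :: comm_ring_1 poly \<Rightarrow> real \<Rightarrow> bool" where
  "t_symmetric f c \<longleftrightarrow> f \<noteq> 0 \<and>
    (\<exists>r s. r \<le> s \<and> f = (\<Sum>i = r..s. monom (coeff f i) i) \<and> coeff f r \<noteq> 0 \<and> coeff f s \<noteq> 0 \<and>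
       c = (real s + real r) / 2 \<and>
       (\<forall>i \<in> {0..s - r}. coeff f (r + i) = coeff f (s - i)))"

end

theory Submission
  imports Defs "HOL-Library.Product_Lexorder" "HOL-Combinatorics.Cycles"
begin

text \<open>
  Bar the letter \<open>\<sigma>(i)\<close> of a permutation whenever \<open>i\<close> is an excedance, let barred letters precede
  unbarred ones, and let \<open>D(\<sigma>)\<close> be the descent set of the barred word, with position 0 added when 1
  is not fixed. Passing from ordinary to barred descents changes the descent status exactly where the
  bar status changes, and summation by parts gives \<open>des = |D|\<close> and \<open>maj - exc = \<Sum>D\<close>. So the
  coefficient of \<open>t\<close> to the power \<open>j\<close> is the sum of \<open>q\<close> to the \<open>\<Sum>D\<close> times \<open>p\<close> to the \<open>|D|\<close> over
  the permutations of cycle type \<open>\<lambda>\<close> with \<open>j\<close> excedances. It suffices that for every set \<open>S\<close>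
  equally many of these with \<open>D(\<sigma>) = S\<close> have \<open>j\<close> and \<open>n - k - j\<close> excedances; by
  inclusion-exclusion \<open>D(\<sigma>) = S\<close> may be relaxed to \<open>D(\<sigma>) \<subseteq> S\<close>.

  The set \<open>S\<close> cuts \<open>{0..n}\<close> into consecutive blocks, and \<open>D(\<sigma>) \<subseteq> S\<close> means that within each block
  the barred word increases; such a \<open>\<sigma>\<close> is called compatible. Replacing every number by its block
  turns the cycles of \<open>\<sigma>\<close> into necklaces whose arcs are coloured by the excedances. Reversing all
  necklaces, that is, passing to the inverse permutation, keeps the cycle type and turns \<open>j\<close>
  excedances into \<open>n - k - j\<close>, because exactly the \<open>k\<close> fixed points are neither excedances of \<open>\<sigma>\<close>
  nor of its inverse. The inverse need not be compatible, but it can be relabelled within the blocks,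
  keeping the colours, so that it becomes compatible
  (\<open>compatible_conjugate_of_inverse_exists\<close>). As a compatible permutation is determined by its
  class under such relabellings (\<open>compatible_unique\<close>), this reversal is injective, and comparing
  \<open>j\<close> with \<open>n - k - j\<close> in both directions gives equality of the two numbers.

  Both facts are versions of the Gessel-Reutenauer correspondence between permutations and multisets
  of primitive necklaces. Necklaces need not be formed as objects: every \<open>i\<close> is assigned the real
  number whose digits are the letters (block, colour) read along the cycle from \<open>i\<close>. The permutation
  then acts as multiplication by the base modulo 1, which is increasing on the numbers with a given
  leading digit and expands distances. Sorting by these numbers produces a compatible permutation,
  and expansion forces a compatible permutation to be sorted by them already.
\<close>

section \<open>Digit expansions along a map\<close>

text \<open>
  The base-\<open>(M + 2)\<close> number \<open>0.a(i) a(f i) a(f (f i)) ...\<close>, which records the infinite word that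
  the letters \<open>a\<close> spell out along the \<open>f\<close>-trajectory of \<open>i\<close>. When all letters are at most \<open>M\<close>,
  the largest digit \<open>M + 1\<close> never occurs, so expansions are unique and the numerical order is the
  lexicographic order of the words.
\<close>

definition expansion :: "nat \<Rightarrow> ('a \<Rightarrow> nat) \<Rightarrow> ('a \<Rightarrow> 'a) \<Rightarrow> 'a \<Rightarrow> real" where
  "expansion M a f i = (\<Sum>k. real (a ((f ^^ k) i)) / (real M + 2) ^ Suc k)"

context
  fixes M :: nat and a :: "'a \<Rightarrow> nat" and f :: "'a \<Rightarrow> 'a"
  assumes letter_le: "\<And>i. a i \<le> M"
begin

lemma expansion_geometric_bound:
  "(\<lambda>k. real M / (real M + 2) ^ Suc k) sums (real M / (real M + 1))"
proof -
  have "(\<lambda>k. (real M / (real M + 2)) * (1 / (real M + 2)) ^ k) sums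
      ((real M / (real M + 2)) * (1 / (1 - 1 / (real M + 2))))"
    by (intro sums_mult geometric_sums) simp
  also have "(real M / (real M + 2)) * (1 / (1 - 1 / (real M + 2))) = real M / (real M + 1)"
    by (simp add: divide_simps)
  finally show ?thesis
    by (simp add: power_divide)
qed

lemma expansion_summable: "summable (\<lambda>k. real (a ((f ^^ k) i)) / (real M + 2) ^ Suc k)"
proof (rule summable_comparison_test)
  show "\<exists>N. \<forall>k\<ge>N. norm (real (a ((f ^^ k) i)) / (real M + 2) ^ Suc k)
      \<le> real M / (real M + 2) ^ Suc k"
    using letter_le by (auto intro!: divide_right_mono)
  show "summable (\<lambda>k. real M / (real M + 2) ^ Suc k)"
    using expansion_geometric_bound by (rule sums_summable)
qed

lemma expansion_nonneg: "0 \<le> expansion M a f i"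
  unfolding expansion_def by (intro suminf_nonneg expansion_summable) simp

lemma expansion_less_1: "expansion M a f i < 1"
proof -
  have "expansion M a f i \<le> (\<Sum>k. real M / (real M + 2) ^ Suc k)"
    unfolding expansion_def
    using letter_le sums_summable[OF expansion_geometric_bound]
    by (intro suminf_le expansion_summable divide_right_mono) auto
  also have "\<dots> = real M / (real M + 1)"
    using expansion_geometric_bound by (simp add: sums_iff)
  also have "\<dots> < 1" by simp
  finally show ?thesis .
qed

text \<open>Applying \<open>f\<close> strips the leading digit: it acts on expansions as \<open>x \<mapsto> (M + 2) x mod 1\<close>.\<close>

lemma expansion_step: "(real M + 2) * expansion M a f i = real (a i) + expansion M a f (f i)"
proof -
  let ?t = "\<lambda>k. real (a ((f ^^ k) i)) / (real M + 2) ^ Suc k"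
  have "expansion M a f i - ?t 0 = (\<Sum>k. ?t (Suc k))"
    unfolding expansion_def using suminf_split_head[OF expansion_summable] by simp
  also have "\<dots> = (\<Sum>k. real (a ((f ^^ k) (f i))) / (real M + 2) ^ Suc k / (real M + 2))"
    by (simp add: funpow_swap1 mult_ac)
  also have "\<dots> = expansion M a f (f i) / (real M + 2)"
    unfolding expansion_def by (intro suminf_divide expansion_summable)
  finally show ?thesis by (simp add: field_simps)
qed

lemma expansion_less_if_letter_less:
  assumes "a i < a j" shows "expansion M a f i < expansion M a f j"
proof -
  have "real (a i) + 1 \<le> real (a j)" using assms by simp
  then have "(real M + 2) * expansion M a f i < (real M + 2) * expansion M a f j"
    using expansion_step[of i] expansion_step[of j] expansion_less_1[of "f i"]
      expansion_nonneg[of "f j"] by linarith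
  then show ?thesis by simp
qed

lemma letter_eq_if_expansion_eq:
  "expansion M a f i = expansion M a f j \<Longrightarrow> a i = a j"
  using expansion_less_if_letter_less[of i j] expansion_less_if_letter_less[of j i]
  by (metis less_irrefl linorder_neqE_nat)

lemma letter_le_if_expansion_le:
  "expansion M a f i \<le> expansion M a f j \<Longrightarrow> a i \<le> a j"
  using expansion_less_if_letter_less[of j i] by (meson not_le)

lemma expansion_step_diff:
  assumes "a i = a j"
  shows "expansion M a f (f i) - expansion M a f (f j)
    = (real M + 2) * (expansion M a f i - expansion M a f j)"
  using expansion_step[of i] expansion_step[of j] assms by (simp add: algebra_simps)

lemma expansion_step_less_iff:
  assumes "a i = a j"
  shows "expansion M a f (f i) < expansion M a f (f j) \<longleftrightarrow> expansion M a f i < expansion M a f j"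
  using expansion_step[of i] expansion_step[of j] assms
    mult_less_cancel_left_pos[of "real M + 2" "expansion M a f i" "expansion M a f j"]
  by linarith

lemma expansion_step_eq:
  assumes "expansion M a f i = expansion M a f j"
  shows "expansion M a f (f i) = expansion M a f (f j)"
  using expansion_step_diff[OF letter_eq_if_expansion_eq[OF assms]] assms by simp

text \<open>Going once around a cycle, equality of words propagates backwards as well.\<close>

lemma expansion_eq_if_step_eq:
  assumes "permutation f" and eq: "expansion M a f (f i) = expansion M a f (f j)"
  shows "expansion M a f i = expansion M a f j"
proof -
  obtain p where p: "f ^^ p = id" "p > 0"
    using permutation_is_nilpotent[OF assms(1)] by blast
  have "expansion M a f ((f ^^ k) (f i)) = expansion M a f ((f ^^ k) (f j))" for k
    by (induction k) (auto simp: eq intro: expansion_step_eq)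
  from this[of "p - 1"] have "expansion M a f ((f ^^ p) i) = expansion M a f ((f ^^ p) j)"
    using p(2) funpow_Suc_right[of "p - 1" f] by simp
  then show ?thesis by (simp add: p(1))
qed

end

lemma expansion_conjugate:
  assumes "\<And>i. a' (w i) = a i" and "\<And>i. w (f i) = f' (w i)"
  shows "expansion M a' f' (w i) = expansion M a f i"
proof -
  have "(f' ^^ k) (w i) = w ((f ^^ k) i)" for k
    by (induction k) (simp_all add: assms(2))
  then show ?thesis by (simp add: expansion_def assms(1))
qed

section \<open>Sorting by a permutation\<close>

text \<open>
  Two weakly increasing rearrangements of the same values coincide. Otherwise, at a position \<open>i\<close>
  with \<open>u i < v i\<close>, the value \<open>v i\<close> would exceed more than \<open>i\<close> entries of \<open>u\<close> but at most \<open>i\<close>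
  entries of \<open>v\<close>.
\<close>

lemma monotone_rearrangement_le:
  fixes u v :: "nat \<Rightarrow> 'a :: linorder"
  assumes w: "w permutes {..n}" and "\<And>i. i \<le> n \<Longrightarrow> v (w i) = u i"
    and u: "mono_on {..n} u" and v: "mono_on {..n} v" and "i \<le> n"
  shows "v i \<le> u i"
proof (rule ccontr)
  assume "\<not> v i \<le> u i"
  then have less: "u i < v i" by simp
  have wn: "w j \<le> n \<longleftrightarrow> j \<le> n" for j using permutes_in_image[OF w, of j] by simp
  have "w ` {j. j \<le> n \<and> u j < v i} = {j. j \<le> n \<and> v j < v i}"
  proof (intro equalityI subsetI)
    fix x assume "x \<in> w ` {j. j \<le> n \<and> u j < v i}"
    then obtain y where "x = w y" "y \<le> n" "u y < v i" by blast
    then show "x \<in> {j. j \<le> n \<and> v j < v i}" using assms(2)[of y] wn[of y] by simp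
  next
    fix x assume x: "x \<in> {j. j \<le> n \<and> v j < v i}"
    then have "x \<in> w ` {..n}" by (simp add: permutes_image[OF w])
    then obtain y where y: "y \<le> n" "x = w y" by blast
    then have "u y < v i" using x assms(2)[of y] by simp
    with y show "x \<in> w ` {j. j \<le> n \<and> u j < v i}" by blast
  qed
  then have eq: "card {j. j \<le> n \<and> u j < v i} = card {j. j \<le> n \<and> v j < v i}"
    using card_image[OF inj_on_subset[OF permutes_inj[OF w] subset_UNIV],
        of "{j. j \<le> n \<and> u j < v i}"] by simp
  have "{..i} \<subseteq> {j. j \<le> n \<and> u j < v i}"
  proof
    fix j assume j: "j \<in> {..i}"
    then have "u j \<le> u i" using mono_onD[OF u, of j i] \<open>i \<le> n\<close> by simp
    then show "j \<in> {j. j \<le> n \<and> u j < v i}" using less j \<open>i \<le> n\<close> by simp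
  qed
  from card_mono[OF _ this] have 1: "Suc i \<le> card {j. j \<le> n \<and> u j < v i}" by simp
  have "{j. j \<le> n \<and> v j < v i} \<subseteq> {..<i}"
  proof
    fix j assume j: "j \<in> {j. j \<le> n \<and> v j < v i}"
    then have "\<not> i \<le> j" using mono_onD[OF v, of i j] \<open>i \<le> n\<close> by auto
    then show "j \<in> {..<i}" by simp
  qed
  from card_mono[OF _ this] have "card {j. j \<le> n \<and> v j < v i} \<le> i" by simp
  with 1 eq show False by simp
qed

lemma monotone_rearrangement_unique:
  fixes u v :: "nat \<Rightarrow> 'a :: linorder"
  assumes w: "w permutes {..n}" and vw: "\<And>i. i \<le> n \<Longrightarrow> v (w i) = u i"
    and u: "mono_on {..n} u" and v: "mono_on {..n} v" and i: "i \<le> n"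
  shows "u i = v i"
proof (rule antisym)
  show "v i \<le> u i" using monotone_rearrangement_le[OF assms] .
  have inv: "u (inv w j) = v j" if "j \<le> n" for j
    using vw[of "inv w j"] permutes_inverses[OF w] permutes_in_image[OF permutes_inv[OF w], of j]
      that by simp
  show "u i \<le> v i" using monotone_rearrangement_le[OF permutes_inv[OF w] inv v u i] .
qed

lemma sorting_permutation_exists:
  fixes key :: "nat \<Rightarrow> 'a :: linorder"
  assumes inj: "inj_on key {..n}"
  obtains w where "w permutes {..n}"
    and "\<And>i j. i \<le> n \<Longrightarrow> j \<le> n \<Longrightarrow> w i < w j \<longleftrightarrow> key i < key j"
proof
  define w where "w i = (if i \<le> n then card {l \<in> {..n}. key l < key i} else i)" for i
  have mono: "w i < w j" if "i \<le> n" "j \<le> n" "key i < key j" for i j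
  proof -
    have "{l \<in> {..n}. key l < key i} \<subset> {l \<in> {..n}. key l < key j}"
    proof (rule psubsetI)
      show "{l \<in> {..n}. key l < key i} \<subseteq> {l \<in> {..n}. key l < key j}"
        using less_trans[OF _ \<open>key i < key j\<close>] by blast
      show "{l \<in> {..n}. key l < key i} \<noteq> {l \<in> {..n}. key l < key j}"
        using that by blast
    qed
    then show ?thesis using that by (simp add: w_def psubset_card_mono)
  qed
  show "w i < w j \<longleftrightarrow> key i < key j" if "i \<le> n" "j \<le> n" for i j
    using mono[of i j] mono[of j i] that inj_onD[OF inj, of i j]
    by (cases "key i" "key j" rule: linorder_cases) auto
  have "inj_on w {..n}"
  proof (rule inj_onI)
    fix i j assume "i \<in> {..n}" "j \<in> {..n}" "w i = w j"
    then show "i = j"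
      using mono[of i j] mono[of j i] inj_onD[OF inj, of i j]
      by (cases "key i" "key j" rule: linorder_cases) auto
  qed
  moreover have "w ` {..n} \<subseteq> {..n}"
  proof
    fix x assume "x \<in> w ` {..n}"
    then obtain i where i: "i \<le> n" "x = card {l \<in> {..n}. key l < key i}" by (auto simp: w_def)
    have "{l \<in> {..n}. key l < key i} \<subset> {..n}" using i by auto
    then have "card {l \<in> {..n}. key l < key i} < card {..n}" by (intro psubset_card_mono) auto
    then show "x \<in> {..n}" using i by simp
  qed
  ultimately have "bij_betw w {..n} {..n}"
    by (simp add: bij_betw_def endo_inj_surj)
  then show "w permutes {..n}"
    by (intro bij_imp_permutes) (auto simp: w_def)
qed

lemma strict_mono_permutation_is_identity:
  fixes f :: "nat \<Rightarrow> nat"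
  assumes f: "f permutes {..n}" and mono: "strict_mono_on {..n} f" and i: "i \<le> n"
  shows "f i = i"
proof -
  have "id i = f i"
  proof (rule monotone_rearrangement_unique[OF permutes_inv[OF f] _ _ _ i])
    show "mono_on {..n} (id :: nat \<Rightarrow> nat)" by (simp add: mono_on_def)
    show "mono_on {..n} f" using mono by (rule strict_mono_on_imp_mono_on)
  qed (simp add: permutes_inverses[OF f])
  then show ?thesis by simp
qed

text \<open>
  A relation under which related points keep their order under every power of a permutation cannot
  relate two points of one cycle: the power of \<open>f\<close> that carries \<open>i\<close> up to \<open>j\<close> would push \<open>i\<close>
  upwards forever.
\<close>

lemma no_related_pair_in_orbit:
  fixes f :: "nat \<Rightarrow> nat"
  assumes perm: "f permutes {..n}"
    and R: "\<And>i j. i \<le> n \<Longrightarrow> j \<le> n \<Longrightarrow> i < j \<Longrightarrow> R i j \<Longrightarrow> f i < f j \<and> R (f i) (f j)"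
    and "i \<le> n" "j \<in> orbit f i" "i < j" "R i j"
  shows False
proof -
  obtain d where d: "j = (f ^^ d) i" using assms(4) by (auto simp: orbit_altdef)
  have in_n: "(f ^^ k) l \<le> n" if "l \<le> n" for k l
    using that permutes_in_funpow_image[OF perm] by simp
  have step: "(f ^^ k) i < (f ^^ k) j \<and> R ((f ^^ k) i) ((f ^^ k) j)" for k
  proof (induction k)
    case 0 then show ?case using assms by simp
  next
    case (Suc k)
    have "j \<le> n" using in_n[OF \<open>i \<le> n\<close>] d by simp
    then show ?case using Suc R in_n \<open>i \<le> n\<close> by simp
  qed
  have "k \<le> (f ^^ (k * d)) i" for k
  proof (induction k)
    case (Suc k)
    have "(f ^^ (Suc k * d)) i = (f ^^ (k * d)) j"
      by (simp add: d add.commute[of d] funpow_add)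
    then show ?case using Suc step[of "k * d"] by simp
  qed simp
  from this[of "Suc n"] in_n[OF \<open>i \<le> n\<close>, of "Suc n * d"] show False by simp
qed

section \<open>Compatible permutations\<close>

text \<open>
  A pair of a block number and a colour, encoded as a number: within a block, an excedance (a barred letter) comes
  before a non-excedance (an unbarred one).
\<close>

definition letter :: "(nat \<Rightarrow> nat) \<Rightarrow> (nat \<Rightarrow> nat) \<Rightarrow> nat \<Rightarrow> nat" where
  "letter b \<sigma> i = 2 * b i + (if i < \<sigma> i then 0 else 1)"

text \<open>
  The barred word has no descent inside a block. As the block numbers increase weakly, one
  lexicographic condition expresses this for all blocks together.
\<close>

definition compatible :: "(nat \<Rightarrow> nat) \<Rightarrow> nat \<Rightarrow> (nat \<Rightarrow> nat) \<Rightarrow> bool" where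
  "compatible b n \<sigma> \<longleftrightarrow>
    \<sigma> permutes {..n} \<and> strict_mono_on {..n} (\<lambda>i. (letter b \<sigma> i, \<sigma> i))"

text \<open>
  Conjugacy under the relabellings that stay inside the blocks. The colours are required to be
  transported, because a relabelling may turn an excedance into a non-excedance.
\<close>

definition block_conjugate ::
  "(nat \<Rightarrow> nat) \<Rightarrow> nat \<Rightarrow> (nat \<Rightarrow> nat) \<Rightarrow> (nat \<Rightarrow> nat) \<Rightarrow> bool" where
  "block_conjugate b n \<sigma> \<tau> \<longleftrightarrow>
    (\<exists>w. w permutes {..n} \<and> (\<forall>i. b (w i) = b i) \<and> (\<forall>i. w (\<sigma> i) = \<tau> (w i)) \<and>
      (\<forall>i. i < \<sigma> i \<longleftrightarrow> w i < \<tau> (w i)))"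

lemma letter_eq_iff:
  "letter b \<sigma> i = letter c \<tau> j \<longleftrightarrow> b i = c j \<and> (i < \<sigma> i \<longleftrightarrow> j < \<tau> j)"
  unfolding letter_def by (auto; presburger)

lemma block_le_if_letter_le: "letter b \<sigma> i \<le> letter b \<tau> j \<Longrightarrow> b i \<le> b j"
  unfolding letter_def by (auto split: if_splits)

lemma compatible_permutes: "compatible b n \<sigma> \<Longrightarrow> \<sigma> permutes {..n}"
  by (simp add: compatible_def)

lemma compatible_less:
  assumes "compatible b n \<sigma>" "i < j" "j \<le> n"
  shows "letter b \<sigma> i < letter b \<sigma> j \<or> letter b \<sigma> i = letter b \<sigma> j \<and> \<sigma> i < \<sigma> j"
  using assms strict_mono_onD[of "{..n}" "\<lambda>i. (letter b \<sigma> i, \<sigma> i)" i j]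
  by (auto simp: compatible_def)

lemma block_conjugate_sym:
  assumes "block_conjugate b n \<sigma> \<tau>" shows "block_conjugate b n \<tau> \<sigma>"
proof -
  obtain w where w: "w permutes {..n}" "\<And>i. b (w i) = b i" "\<And>i. w (\<sigma> i) = \<tau> (w i)"
      "\<And>i. i < \<sigma> i \<longleftrightarrow> w i < \<tau> (w i)"
    using assms unfolding block_conjugate_def by blast
  note inverses = permutes_inverses[OF w(1)]
  have step: "inv w (\<tau> i) = \<sigma> (inv w i)" for i
    using w(3)[of "inv w i"] inverses by metis
  moreover have "b (inv w i) = b i" for i
    using w(2)[of "inv w i"] by (simp add: inverses)
  moreover have "i < \<tau> i \<longleftrightarrow> inv w i < \<sigma> (inv w i)" for i
    using w(4)[of "inv w i"] by (simp add: inverses)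
  ultimately show ?thesis
    unfolding block_conjugate_def using permutes_inv[OF w(1)] by blast
qed

lemma block_conjugate_trans:
  assumes "block_conjugate b n \<sigma> \<tau>" "block_conjugate b n \<tau> \<rho>"
  shows "block_conjugate b n \<sigma> \<rho>"
proof -
  obtain v where v: "v permutes {..n}" "\<forall>i. b (v i) = b i" "\<forall>i. v (\<sigma> i) = \<tau> (v i)"
      "\<forall>i. i < \<sigma> i \<longleftrightarrow> v i < \<tau> (v i)"
    using assms(1) unfolding block_conjugate_def by blast
  obtain w where w: "w permutes {..n}" "\<forall>i. b (w i) = b i" "\<forall>i. w (\<tau> i) = \<rho> (w i)"
      "\<forall>i. i < \<tau> i \<longleftrightarrow> w i < \<rho> (w i)"
    using assms(2) unfolding block_conjugate_def by blast
  show ?thesis unfolding block_conjugate_def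
    using permutes_compose[OF v(1) w(1)] v(2-) w(2-) by (intro exI[of _ "w \<circ> v"]) simp
qed

text \<open>
  An excedance of \<open>inv \<sigma>\<close> at \<open>i\<close> is an arc \<open>inv \<sigma> i \<mapsto> i\<close> of \<open>\<sigma>\<close> that goes down. An arc of \<open>\<sigma>\<close>
  that does not go up either goes down or is a loop, and conjugation takes loops to loops.
\<close>

lemma block_conjugate_inv:
  assumes "block_conjugate b n \<sigma> \<tau>" "\<sigma> permutes {..n}" "\<tau> permutes {..n}"
  shows "block_conjugate b n (inv \<sigma>) (inv \<tau>)"
proof -
  obtain w where w: "w permutes {..n}" "\<And>i. b (w i) = b i" "\<And>i. w (\<sigma> i) = \<tau> (w i)"
      "\<And>i. i < \<sigma> i \<longleftrightarrow> w i < \<tau> (w i)"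
    using assms(1) unfolding block_conjugate_def by blast
  note \<sigma> = permutes_inverses[OF assms(2)] and \<tau> = permutes_inverses[OF assms(3)]
  have step: "w (inv \<sigma> i) = inv \<tau> (w i)" for i
    using w(3)[of "inv \<sigma> i"] by (metis \<sigma>(1) \<tau>(2))
  have "i < inv \<sigma> i \<longleftrightarrow> w i < inv \<tau> (w i)" for i
  proof -
    have "inv \<sigma> i < i \<longleftrightarrow> inv \<tau> (w i) < w i"
      using w(4)[of "inv \<sigma> i"] by (simp add: \<sigma> \<tau> step)
    moreover have "inv \<sigma> i = i \<longleftrightarrow> inv \<tau> (w i) = w i"
      using step[of i] permutes_inj[OF w(1)] by (metis injD)
    ultimately show ?thesis by linarith
  qed
  with w(1,2) step show ?thesis unfolding block_conjugate_def by blast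
qed

context
  fixes b :: "nat \<Rightarrow> nat" and n K :: nat
  assumes block_mono: "mono b" and block_le: "\<And>i. b i \<le> K"
begin

lemma letter_bounded: "letter b \<sigma> i \<le> 2 * K + 1"
  using block_le[of i] by (simp add: letter_def)

abbreviation word_value :: "(nat \<Rightarrow> nat) \<Rightarrow> nat \<Rightarrow> real" where
  "word_value \<sigma> \<equiv> expansion (2 * K + 1) (letter b \<sigma>) \<sigma>"

lemmas word_value_le_imp_letter_le =
  letter_le_if_expansion_le[of "letter b \<sigma>" "2 * K + 1" \<sigma> for \<sigma>, OF letter_bounded]

lemmas word_value_eq_imp_letter_eq =
  letter_eq_if_expansion_eq[of "letter b \<sigma>" "2 * K + 1" \<sigma> for \<sigma>, OF letter_bounded]

lemmas word_value_step_less_iff =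
  expansion_step_less_iff[of "letter b \<sigma>" "2 * K + 1" i j \<sigma> for \<sigma> i j, OF letter_bounded]

subsection \<open>A compatible permutation is determined by its block conjugacy class\<close>

text \<open>
  Suppose \<open>i < j\<close> but the word of \<open>i\<close> has the larger value. Compatibility forces equal first
  letters and \<open>\<sigma> i < \<sigma> j\<close>, so the same situation recurs at \<open>\<sigma> i\<close>, \<open>\<sigma> j\<close> with the gap between the
  values multiplied by the base; but the gaps stay below 1.
\<close>

lemma word_value_mono:
  assumes comp: "compatible b n \<sigma>"
  shows "mono_on {..n} (word_value \<sigma>)"
proof (rule mono_onI, rule ccontr)
  fix i j assume ij: "i \<in> {..n}" "j \<in> {..n}" "i \<le> j" "\<not> word_value \<sigma> i \<le> word_value \<sigma> j"
  define gap where "gap = word_value \<sigma> i - word_value \<sigma> j"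
  let ?B = "real (2 * K + 1) + 2"
  have in_n: "(\<sigma> ^^ k) l \<le> n" if "l \<le> n" for k l
    using that permutes_in_funpow_image[OF compatible_permutes[OF comp]] by simp
  have gap: "gap > 0" using ij(4) by (simp add: gap_def)
  have "(\<sigma> ^^ k) i < (\<sigma> ^^ k) j \<and>
      word_value \<sigma> ((\<sigma> ^^ k) i) - word_value \<sigma> ((\<sigma> ^^ k) j) = ?B ^ k * gap" for k
  proof (induction k)
    case 0
    have "i \<noteq> j" using ij(4) by auto
    then show ?case using ij(3) by (simp add: gap_def)
  next
    case (Suc k)
    let ?i = "(\<sigma> ^^ k) i" and ?j = "(\<sigma> ^^ k) j"
    have "?B ^ k * gap > 0" using gap by simp
    then have "word_value \<sigma> ?j \<le> word_value \<sigma> ?i" using Suc by linarith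
    then have "letter b \<sigma> ?j \<le> letter b \<sigma> ?i" by (rule word_value_le_imp_letter_le)
    with compatible_less[OF comp, of ?i ?j] Suc in_n[of j] ij(2)
    have same: "letter b \<sigma> ?i = letter b \<sigma> ?j" and "\<sigma> ?i < \<sigma> ?j" by auto
    moreover have "word_value \<sigma> (\<sigma> ?i) - word_value \<sigma> (\<sigma> ?j)
        = ?B * (word_value \<sigma> ?i - word_value \<sigma> ?j)"
      using expansion_step_diff[of "letter b \<sigma>", OF letter_bounded same] .
    ultimately show ?case using Suc by simp
  qed
  note gaps = this
  have "?B ^ k * gap < 1" for k
    using gaps[of k]
      expansion_less_1[of "letter b \<sigma>" "2 * K + 1" \<sigma> "(\<sigma> ^^ k) i", OF letter_bounded]
      expansion_nonneg[of "letter b \<sigma>" "2 * K + 1" \<sigma> "(\<sigma> ^^ k) j", OF letter_bounded]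
    by linarith
  moreover obtain k where "1 / gap < ?B ^ k" using real_arch_pow[of ?B "1 / gap"] by auto
  then have "1 < ?B ^ k * gap" by (simp add: pos_divide_less_eq[OF gap])
  ultimately show False by (meson less_asym)
qed

text \<open>
  By sortedness both permutations carry the same words, and \<open>inv \<tau> \<circ> \<sigma>\<close> maps every class of equal
  words increasingly to itself.
\<close>

lemma compatible_unique:
  assumes \<sigma>: "compatible b n \<sigma>" and \<tau>: "compatible b n \<tau>" and conj: "block_conjugate b n \<sigma> \<tau>"
  shows "\<sigma> = \<tau>"
proof -
  obtain w where w: "w permutes {..n}" "\<And>i. b (w i) = b i" "\<And>i. w (\<sigma> i) = \<tau> (w i)"
      "\<And>i. i < \<sigma> i \<longleftrightarrow> w i < \<tau> (w i)"
    using conj unfolding block_conjugate_def by blast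
  note \<sigma>p = compatible_permutes[OF \<sigma>] and \<tau>p = compatible_permutes[OF \<tau>]
  let ?x = "word_value \<tau>"
  have letter_w: "letter b \<tau> (w i) = letter b \<sigma> i" for i
    using w(2,4) by (simp add: letter_eq_iff)
  have letters: "mono_on {..n} (letter b \<rho>)" if "compatible b n \<rho>" for \<rho>
    using compatible_less[OF that] by (intro mono_onI) (metis atMost_iff le_less order_refl)
  have same_letter: "letter b \<sigma> i = letter b \<tau> i" if "i \<le> n" for i
    using monotone_rearrangement_unique[where u = "letter b \<sigma>" and v = "letter b \<tau>",
        OF w(1) letter_w letters[OF \<sigma>] letters[OF \<tau>] that] .
  have word_w: "?x (w i) = word_value \<sigma> i" for i
    using expansion_conjugate[where a = "letter b \<sigma>" and a' = "letter b \<tau>" and w = w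
        and f = \<sigma> and f' = \<tau>, OF letter_w w(3)] .
  have same_word: "word_value \<sigma> i = ?x i" if "i \<le> n" for i
    using monotone_rearrangement_unique[where u = "word_value \<sigma>" and v = ?x,
        OF w(1) word_w word_value_mono[OF \<sigma>] word_value_mono[OF \<tau>] that] .
  define \<rho> where "\<rho> = inv \<tau> \<circ> \<sigma>"
  have \<rho>: "\<rho> permutes {..n}"
    unfolding \<rho>_def by (intro permutes_compose \<sigma>p permutes_inv \<tau>p)
  have \<rho>_le: "\<rho> i \<le> n \<longleftrightarrow> i \<le> n" and \<sigma>_le: "\<sigma> i \<le> n \<longleftrightarrow> i \<le> n" for i
    using permutes_in_image[OF \<rho>, of i] permutes_in_image[OF \<sigma>p, of i] by simp_all
  have \<tau>\<rho>: "\<tau> (\<rho> i) = \<sigma> i" for i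
    by (simp add: \<rho>_def permutes_inverses[OF \<tau>p])
  have word_\<rho>: "?x (\<rho> i) = ?x i" if i: "i \<le> n" for i
  proof (rule expansion_eq_if_step_eq[OF letter_bounded])
    show "permutation \<tau>" using \<tau>p by (auto simp: permutation_permutes)
    have "?x (\<sigma> i) = word_value \<sigma> (\<sigma> i)" using same_word[of "\<sigma> i"] i \<sigma>_le by simp
    then show "?x (\<tau> (\<rho> i)) = ?x (\<tau> i)"
      using expansion_step[of "letter b \<sigma>" "2 * K + 1" \<sigma> i, OF letter_bounded]
        expansion_step[of "letter b \<tau>" "2 * K + 1" \<tau> i, OF letter_bounded]
        same_letter[OF i] same_word[OF i] by (simp add: \<tau>\<rho>)
  qed
  have "strict_mono_on {..n} \<rho>"
  proof (rule strict_mono_onI)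
    fix i j assume ij: "i \<in> {..n}" "j \<in> {..n}" "i < j"
    have ne: "\<rho> i \<noteq> \<rho> j" using ij(3) permutes_inj[OF \<rho>] by (metis injD less_irrefl)
    show "\<rho> i < \<rho> j"
    proof (rule ccontr)
      assume "\<not> \<rho> i < \<rho> j"
      with ne have less: "\<rho> j < \<rho> i" by simp
      then have "?x (\<rho> j) \<le> ?x (\<rho> i)"
        using mono_onD[OF word_value_mono[OF \<tau>], of "\<rho> j" "\<rho> i"] ij \<rho>_le by simp
      moreover have "?x i \<le> ?x j"
        using mono_onD[OF word_value_mono[OF \<tau>], of i j] ij by simp
      ultimately have eq: "?x i = ?x j" and eq': "?x (\<rho> i) = ?x (\<rho> j)"
        using ij word_\<rho> by simp_all
      have "letter b \<sigma> i = letter b \<sigma> j"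
        using word_value_eq_imp_letter_eq[OF eq] same_letter ij by simp
      then have "\<sigma> i < \<sigma> j" using compatible_less[OF \<sigma> ij(3)] ij by simp
      moreover have "\<tau> (\<rho> j) < \<tau> (\<rho> i)"
        using compatible_less[OF \<tau> less] word_value_eq_imp_letter_eq[OF eq'] \<rho>_le ij by simp
      ultimately show False by (simp add: \<tau>\<rho>)
    qed
  qed
  then have "\<rho> i = i" if "i \<le> n" for i
    using strict_mono_permutation_is_identity[OF \<rho>] that by blast
  then have "\<sigma> i = \<tau> i" if "i \<le> n" for i using that \<tau>\<rho>[of i] by simp
  moreover have "\<sigma> i = \<tau> i" if "\<not> i \<le> n" for i
    using that permutes_not_in[OF \<sigma>p] permutes_not_in[OF \<tau>p] by simp
  ultimately show ?thesis by blast
qed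

subsection \<open>The inverse of a compatible permutation can be sorted\<close>

text \<open>
  No cycle of the inverse spells a power of a shorter word: two points of a cycle with the same
  word would keep their order under all powers of \<open>\<sigma>\<close>.
\<close>

lemma inverse_word_values_distinct_in_orbit:
  assumes comp: "compatible b n \<sigma>" and "i \<le> n" "j \<in> orbit (inv \<sigma>) i"
    and "word_value (inv \<sigma>) i = word_value (inv \<sigma>) j"
  shows "i = j"
proof -
  note \<sigma>p = compatible_permutes[OF comp]
  note inverses = permutes_inverses[OF \<sigma>p]
  have perm: "permutation \<sigma>" using \<sigma>p by (auto simp: permutation_permutes)
  have permi: "permutation (inv \<sigma>)" using permutes_inv[OF \<sigma>p] by (auto simp: permutation_permutes)
  let ?x = "word_value (inv \<sigma>)"
  \<comment> \<open>The second conjunct serves to recover the colours of \<open>\<sigma>\<close> from those of its inverse.\<close>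
  define R where "R k l \<longleftrightarrow> ?x k = ?x l \<and> (\<sigma> k = k \<longleftrightarrow> \<sigma> l = l)" for k l
  have step: "\<sigma> k < \<sigma> l \<and> R (\<sigma> k) (\<sigma> l)" if "k < l" "l \<le> n" "R k l" for k l
  proof -
    have x: "?x (\<sigma> k) = ?x (\<sigma> l)"
    proof (rule expansion_eq_if_step_eq[OF letter_bounded permi])
      show "?x (inv \<sigma> (\<sigma> k)) = ?x (inv \<sigma> (\<sigma> l))"
        using that(3) by (simp only: inverses R_def)
    qed
    have "letter b (inv \<sigma>) k = letter b (inv \<sigma>) l"
      using that(3) word_value_eq_imp_letter_eq[of "inv \<sigma>" k l] by (simp only: R_def)
    then have "b k = b l" by (simp only: letter_eq_iff)
    moreover have "\<sigma> k < k \<longleftrightarrow> \<sigma> l < l"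
      using word_value_eq_imp_letter_eq[OF x] by (simp only: letter_eq_iff inverses)
    moreover have "m < \<sigma> m \<longleftrightarrow> \<not> \<sigma> m < m \<and> \<sigma> m \<noteq> m" for m by auto
    ultimately have "letter b \<sigma> k = letter b \<sigma> l"
      using that(3) by (simp only: R_def letter_eq_iff)
    with compatible_less[OF comp that(1,2)] have "\<sigma> k < \<sigma> l" by simp
    moreover have "\<sigma> (\<sigma> m) = \<sigma> m \<longleftrightarrow> \<sigma> m = m" for m
      by (rule inj_eq[OF permutes_inj[OF \<sigma>p]])
    ultimately show ?thesis using x that(3) by (simp only: R_def)
  qed
  have orbits: "j \<in> orbit \<sigma> i" "i \<in> orbit \<sigma> j"
    using assms(3) orbit_swap[OF permutation_self_in_orbit[OF perm], of j i]
    by (simp_all only: orbit_inv_eq[OF perm])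
  have "\<sigma> i = i \<longleftrightarrow> \<sigma> j = j"
    using orbits orbit_eq_singleton_iff[of \<sigma> i] orbit_eq_singleton_iff[of \<sigma> j]
    by (metis singletonD)
  then have R: "R i j" "R j i" using assms(4) by (simp_all only: R_def)
  have "j \<le> n"
    using permutes_orbit_subset[OF \<sigma>p, of i] orbits(1) assms(2) by blast
  have False if "k < l" "k \<le> n" "l \<in> orbit \<sigma> k" "R k l" for k l
    using no_related_pair_in_orbit[of \<sigma> n R k l, OF \<sigma>p step] that by blast
  then show ?thesis
    using R orbits \<open>i \<le> n\<close> \<open>j \<le> n\<close> by (cases i j rule: linorder_cases) blast+
qed

text \<open>
  Sorting by the words does not change colours: a barred arc (towards the same or a later block)
  increases the value of the word. If it did not, then \<open>\<pi> i\<close> would lie in the block of \<open>i\<close> and be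
  barred as well, and so on along the trajectory of \<open>i\<close>, which would increase forever.
\<close>

lemma word_value_increases_at_excedance:
  assumes \<pi>: "\<pi> permutes {..n}" and "i < \<pi> i"
  shows "word_value \<pi> i < word_value \<pi> (\<pi> i)"
proof (rule ccontr)
  let ?x = "word_value \<pi>"
  assume "\<not> ?x i < ?x (\<pi> i)"
  then have step: "(\<pi> ^^ k) i < \<pi> ((\<pi> ^^ k) i) \<and> \<not> ?x ((\<pi> ^^ k) i) < ?x (\<pi> ((\<pi> ^^ k) i))" for k
  proof (induction k)
    case 0 then show ?case using assms by simp
  next
    case (Suc k)
    let ?i = "(\<pi> ^^ k) i"
    have IH: "?i < \<pi> ?i" "\<not> ?x ?i < ?x (\<pi> ?i)" using Suc by blast+
    then have "letter b \<pi> (\<pi> ?i) \<le> letter b \<pi> ?i"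
      using word_value_le_imp_letter_le[of \<pi> "\<pi> ?i" ?i] by (simp add: not_less)
    moreover have "b ?i \<le> b (\<pi> ?i)" using IH(1) block_mono by (simp add: monoD)
    ultimately have "\<pi> ?i < \<pi> (\<pi> ?i)" and same: "letter b \<pi> ?i = letter b \<pi> (\<pi> ?i)"
      using IH(1) by (auto simp: letter_def split: if_splits)
    then show ?case using IH(2) word_value_step_less_iff[OF same] by simp
  qed
  have "k \<le> (\<pi> ^^ k) i" for k
    by (induction k) (use step Suc_le_eq le_less_trans in \<open>auto simp: Suc_le_eq intro: le_less_trans\<close>)
  moreover have "i \<le> n" using assms permutes_not_in[OF \<pi>, of i] by force
  ultimately show False
    using permutes_in_funpow_image[OF \<pi>, of i "Suc n"] by (metis Suc_n_not_le_n atMost_iff le_trans)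
qed

lemma word_value_decreases_at_anti_excedance:
  assumes \<pi>: "\<pi> permutes {..n}" and "\<pi> i < i"
  shows "word_value \<pi> (\<pi> i) < word_value \<pi> i"
proof (rule ccontr)
  let ?x = "word_value \<pi>"
  assume "\<not> ?x (\<pi> i) < ?x i"
  then have step: "\<pi> ((\<pi> ^^ k) i) < (\<pi> ^^ k) i \<and> \<not> ?x (\<pi> ((\<pi> ^^ k) i)) < ?x ((\<pi> ^^ k) i)" for k
  proof (induction k)
    case 0 then show ?case using assms by simp
  next
    case (Suc k)
    let ?i = "(\<pi> ^^ k) i"
    have IH: "\<pi> ?i < ?i" "\<not> ?x (\<pi> ?i) < ?x ?i" using Suc by blast+
    then have "letter b \<pi> ?i \<le> letter b \<pi> (\<pi> ?i)"
      using word_value_le_imp_letter_le[of \<pi> ?i "\<pi> ?i"] by (simp add: not_less)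
    moreover have "b (\<pi> ?i) \<le> b ?i" using IH(1) block_mono by (simp add: monoD)
    ultimately have "\<not> \<pi> ?i < \<pi> (\<pi> ?i)" and same: "letter b \<pi> (\<pi> ?i) = letter b \<pi> ?i"
      using IH(1) by (auto simp: letter_def split: if_splits)
    moreover have "\<pi> (\<pi> ?i) \<noteq> \<pi> ?i" using IH(1) permutes_inj[OF \<pi>] by (metis injD less_irrefl)
    ultimately show ?case using IH(2) word_value_step_less_iff[OF same] by simp
  qed
  have "(\<pi> ^^ k) i + k \<le> i" for k
  proof (induction k)
    case (Suc k) then show ?case using step[of k] by simp
  qed simp
  from this[of "Suc i"] show False by simp
qed

text \<open>
  The conjugating permutation sorts \<open>{..n}\<close> by the words of the inverse. One step along the inverse
  strips the leading letter, so among equal letters it preserves the order of the words, which is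
  what compatibility asks for.
\<close>

lemma compatible_conjugate_of_inverse_exists:
  assumes comp: "compatible b n \<sigma>"
  shows "\<exists>\<tau>. compatible b n \<tau> \<and> block_conjugate b n (inv \<sigma>) \<tau>"
proof -
  define \<pi> where "\<pi> = inv \<sigma>"
  have \<pi>: "\<pi> permutes {..n}"
    unfolding \<pi>_def by (rule permutes_inv[OF compatible_permutes[OF comp]])
  have perm: "permutation \<pi>" using \<pi> by (auto simp: permutation_permutes)
  have \<pi>_le: "\<pi> i \<le> n \<longleftrightarrow> i \<le> n" for i using permutes_in_image[OF \<pi>, of i] by simp
  let ?x = "word_value \<pi>"
  \<comment> \<open>Equal words lie on different cycles, so any labelling of the cycles breaks the ties
    consistently along \<open>\<pi>\<close>.\<close>
  define key where "key i = (?x i, Min (orbit \<pi> i))" for i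
  have "inj_on key {..n}"
  proof (rule inj_onI)
    fix i j assume ij: "i \<in> {..n}" "j \<in> {..n}" "key i = key j"
    have Min_orbit: "Min (orbit \<pi> k) \<in> orbit \<pi> k" for k
      by (intro Min_in finite_orbit permutation_self_in_orbit perm orbit_nonempty)
    have "Min (orbit \<pi> i) = Min (orbit \<pi> j)" using ij(3) by (simp add: key_def)
    with Min_orbit[of i] Min_orbit[of j]
    have "Min (orbit \<pi> i) \<in> orbit \<pi> i" "Min (orbit \<pi> i) \<in> orbit \<pi> j" by simp_all
    then have "j \<in> orbit \<pi> i"
      by (meson orbit_swap orbit_trans perm permutation_self_in_orbit)
    then show "i = j"
      using inverse_word_values_distinct_in_orbit[OF comp, of i j] ij
      by (simp add: key_def \<pi>_def)
  qed
  then obtain w where w: "w permutes {..n}"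
    and w_less: "\<And>i j. i \<le> n \<Longrightarrow> j \<le> n \<Longrightarrow> w i < w j \<longleftrightarrow> key i < key j"
    using sorting_permutation_exists by blast
  note inverses = permutes_inverses[OF w]
  have inv_le: "inv w i \<le> n \<longleftrightarrow> i \<le> n" for i
    using permutes_in_image[OF permutes_inv[OF w], of i] by simp
  have x_le: "?x (inv w i) \<le> ?x (inv w j)" if "i \<le> j" "j \<le> n" for i j
    using w_less[of "inv w i" "inv w j"] that inv_le
    by (cases "i = j") (auto simp: inverses key_def)
  have block_w: "b (w i) = b i" for i
  proof (cases "i \<le> n")
    case True
    have "mono_on {..n} (b \<circ> inv w)"
      using x_le word_value_le_imp_letter_le block_le_if_letter_le
      by (intro mono_onI) (metis atMost_iff comp_apply)
    moreover have "mono_on {..n} b" using block_mono by (simp add: mono_on_def mono_def)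
    moreover have "w i \<le> n" using permutes_in_image[OF w, of i] True by simp
    ultimately show ?thesis
      using monotone_rearrangement_unique[OF w, of "b \<circ> inv w" b "w i"] by (simp add: inverses)
  next
    case False
    then show ?thesis using permutes_not_in[OF w] by simp
  qed
  define \<tau> where "\<tau> = w \<circ> \<pi> \<circ> inv w"
  have \<tau>w: "\<tau> (w i) = w (\<pi> i)" for i by (simp add: \<tau>_def inverses)
  have colour: "i < \<pi> i \<longleftrightarrow> w i < w (\<pi> i)" for i
  proof (cases "i \<le> n")
    case True
    consider "i < \<pi> i" | "\<pi> i = i" | "\<pi> i < i" by linarith
    then show ?thesis
    proof cases
      case 1
      then show ?thesis
        using word_value_increases_at_excedance[OF \<pi> 1] w_less[of i "\<pi> i"] True \<pi>_le
        by (simp add: key_def)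
    next
      case 3
      then show ?thesis
        using word_value_decreases_at_anti_excedance[OF \<pi> 3] w_less[of i "\<pi> i"] True \<pi>_le
        by (simp add: key_def)
    qed simp
  next
    case False
    then show ?thesis using permutes_not_in[OF \<pi>] by simp
  qed
  have conj: "block_conjugate b n \<pi> \<tau>"
    unfolding block_conjugate_def using w block_w \<tau>w colour by auto
  have letter_w: "letter b \<tau> (w i) = letter b \<pi> i" for i
    using block_w colour by (simp add: letter_eq_iff \<tau>w)
  have "compatible b n \<tau>"
    unfolding compatible_def
  proof
    show "\<tau> permutes {..n}"
      unfolding \<tau>_def by (intro permutes_compose \<pi> w permutes_inv)
    show "strict_mono_on {..n} (\<lambda>i. (letter b \<tau> i, \<tau> i))"
    proof (rule strict_mono_onI)
      fix p q assume pq: "p \<in> {..n}" "q \<in> {..n}" "p < q"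
      define i j where "i = inv w p" and "j = inv w q"
      have wij: "w i = p" "w j = q" by (simp_all add: i_def j_def inverses)
      have ij: "i \<le> n" "j \<le> n" using inv_le pq by (simp_all add: i_def j_def)
      have key: "key i < key j" using w_less[OF ij] pq(3) wij by simp
      then have "letter b \<pi> i \<le> letter b \<pi> j"
        by (intro word_value_le_imp_letter_le) (auto simp: key_def)
      moreover have "w (\<pi> i) < w (\<pi> j)" if same: "letter b \<pi> i = letter b \<pi> j"
      proof -
        have "?x (\<pi> i) < ?x (\<pi> j) \<longleftrightarrow> ?x i < ?x j"
          by (rule word_value_step_less_iff[OF same])
        moreover have "?x i = ?x j \<Longrightarrow> ?x (\<pi> i) = ?x (\<pi> j)"
          by (rule expansion_step_eq[OF letter_bounded])
        ultimately have "key (\<pi> i) < key (\<pi> j)"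
          using key by (auto simp: key_def permutation_orbit_step[OF perm])
        then show ?thesis using w_less \<pi>_le ij by simp
      qed
      ultimately show "(letter b \<tau> p, \<tau> p) < (letter b \<tau> q, \<tau> q)"
        using letter_w[of i] letter_w[of j] \<tau>w[of i] \<tau>w[of j]
        by (auto simp: wij order.order_iff_strict)
    qed
  qed
  with conj show ?thesis unfolding \<pi>_def by blast
qed

end

section \<open>Descents of the barred word\<close>

text \<open>
  Bar the excedances and order the letters as \<open>\<bar>1 < ... < \<bar>n < 1 < ... < n\<close>; these are the descent
  positions of the resulting word. The fixed point 0 is put in front of the word, so that position 0
  is a descent exactly if 1 is not fixed.
\<close>

definition barred_descents :: "nat \<Rightarrow> (nat \<Rightarrow> nat) \<Rightarrow> nat set" where
  "barred_descents n \<sigma> = {x \<in> {..<n}.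
    \<not> ((x < \<sigma> x \<and> \<not> Suc x < \<sigma> (Suc x)) \<or> ((x < \<sigma> x \<longleftrightarrow> Suc x < \<sigma> (Suc x)) \<and> \<sigma> x < \<sigma> (Suc x)))}"

definition block_number :: "nat set \<Rightarrow> nat \<Rightarrow> nat" where
  "block_number S i = card {x \<in> S. x < i}"

lemma block_number_Suc:
  assumes "finite S"
  shows "block_number S (Suc i) = block_number S i + (if i \<in> S then 1 else 0)"
proof -
  have "{x \<in> S. x < Suc i} = (if i \<in> S then insert i {x \<in> S. x < i} else {x \<in> S. x < i})"
    by (auto simp: less_Suc_eq)
  then show ?thesis using assms by (simp add: block_number_def)
qed

lemma block_number_0: "block_number S 0 = 0"
  by (simp add: block_number_def)

lemma block_number_mono: "finite S \<Longrightarrow> mono (block_number S)"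
  by (intro monoI) (auto simp: block_number_def intro!: card_mono)

lemma block_number_le: "finite S \<Longrightarrow> block_number S i \<le> card S"
  by (auto simp: block_number_def intro!: card_mono)

lemma strict_mono_on_atMost_iff:
  fixes g :: "nat \<Rightarrow> 'a :: order"
  shows "strict_mono_on {..n} g \<longleftrightarrow> (\<forall>x<n. g x < g (Suc x))"
proof
  assume "strict_mono_on {..n} g"
  then show "\<forall>x<n. g x < g (Suc x)" by (auto intro: strict_mono_onD)
next
  assume step: "\<forall>x<n. g x < g (Suc x)"
  have "g i < g (i + Suc d)" if "i + Suc d \<le> n" for i d
    using that
  proof (induction d)
    case (Suc d)
    then have "g i < g (i + Suc d)" "g (i + Suc d) < g (Suc (i + Suc d))" using step by simp_all
    then show ?case by simp
  qed (use step in simp)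
  then show "strict_mono_on {..n} g"
    by (intro strict_mono_onI) (metis atMost_iff less_imp_Suc_add add_Suc_right)
qed

lemma compatible_iff_barred_descents_subset:
  assumes \<sigma>: "\<sigma> permutes {..n}" and "finite S"
  shows "compatible (block_number S) n \<sigma> \<longleftrightarrow> barred_descents n \<sigma> \<subseteq> S"
proof -
  have "(letter (block_number S) \<sigma> x, \<sigma> x) < (letter (block_number S) \<sigma> (Suc x), \<sigma> (Suc x))
      \<longleftrightarrow> (x \<in> barred_descents n \<sigma> \<longrightarrow> x \<in> S)" if "x < n" for x
    using that
    by (simp add: letter_def block_number_Suc[OF assms(2)] barred_descents_def)
  moreover have "barred_descents n \<sigma> \<subseteq> {..<n}" by (auto simp: barred_descents_def)
  ultimately show ?thesis
    using \<sigma> by (auto simp: compatible_def strict_mono_on_atMost_iff)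
qed

text \<open>
  A barred letter followed by an unbarred one is a descent of the permutation but not of the barred
  word, and conversely for an unbarred letter followed by a barred one.
\<close>

lemma descent_exchange:
  assumes \<sigma>: "\<sigma> permutes {1..n}" and "x < n"
  shows "of_bool (x \<in> DES n \<sigma>) + of_bool (Suc x < \<sigma> (Suc x))
    = of_bool (x \<in> barred_descents n \<sigma>) + (of_bool (x < \<sigma> x) :: nat)"
proof (cases "x = 0")
  case True
  have "\<sigma> 0 = 0" using permutes_not_in[OF \<sigma>, of 0] by simp
  moreover have "\<sigma> 1 > 0" using permutes_in_image[OF \<sigma>, of 1] assms(2) by simp
  ultimately show ?thesis using True assms(2) by (simp add: DES_def barred_descents_def)
next
  case False
  have "\<sigma> x \<noteq> \<sigma> (Suc x)" using inj_eq[OF permutes_inj[OF \<sigma>]] by simp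
  then show ?thesis
    using False assms(2) by (auto simp: DES_def barred_descents_def)
qed

lemma telescope_exchange:
  fixes d D e :: "nat \<Rightarrow> nat"
  assumes "\<And>x. x < n \<Longrightarrow> d x + e (Suc x) = D x + e x"
  shows "(\<Sum>x<n. d x) + e n = (\<Sum>x<n. D x) + e 0"
  using assms
proof (induction n)
  case (Suc n)
  then have "(\<Sum>x<n. d x) + e n = (\<Sum>x<n. D x) + e 0" "d n + e (Suc n) = D n + e n" by simp_all
  then show ?case by simp
qed simp

lemma telescope_exchange_weighted:
  fixes d D e :: "nat \<Rightarrow> nat"
  assumes "\<And>x. x < n \<Longrightarrow> d x + e (Suc x) = D x + e x"
  shows "(\<Sum>x<n. x * d x) + n * e n = (\<Sum>x<n. x * D x) + (\<Sum>x<n. e (Suc x))"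
  using assms
proof (induction n)
  case (Suc n)
  then have "(\<Sum>x<n. x * d x) + n * e n = (\<Sum>x<n. x * D x) + (\<Sum>x<n. e (Suc x))" by simp
  moreover have "n * d n + n * e (Suc n) = n * D n + n * e n"
    using Suc.prems[of n] by (metis add_mult_distrib2 lessI)
  ultimately show ?case by simp
qed simp

lemma sum_of_bool_lessThan:
  fixes A :: "nat set"
  assumes "A \<subseteq> {..<n}"
  shows "(\<Sum>x<n. of_bool (x \<in> A)) = card A" and "(\<Sum>x<n. x * of_bool (x \<in> A)) = \<Sum>A"
proof -
  have A: "{..<n} \<inter> A = A" using assms by auto
  show "(\<Sum>x<n. of_bool (x \<in> A)) = card A" by (simp add: sum_of_bool_eq A)
  have "(\<Sum>x<n. x * of_bool (x \<in> A)) = (\<Sum>x\<in>A. x * of_bool (x \<in> A))"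
    using assms by (intro sum.mono_neutral_right) auto
  then show "(\<Sum>x<n. x * of_bool (x \<in> A)) = \<Sum>A" by simp
qed

lemma exc_eq_card:
  assumes \<sigma>: "\<sigma> permutes {1..n}"
  shows "exc n \<sigma> = card {i. i < \<sigma> i}"
proof -
  have "{i \<in> {1..<n}. \<sigma> i > i} = {i. i < \<sigma> i}"
  proof (intro equalityI subsetI)
    fix i assume i: "i \<in> {i. i < \<sigma> i}"
    then have "i \<in> {1..n}" using permutes_not_in[OF \<sigma>, of i] by force
    moreover from this have "\<sigma> i \<le> n" using permutes_in_image[OF \<sigma>, of i] by simp
    ultimately show "i \<in> {i \<in> {1..<n}. \<sigma> i > i}" using i by simp
  qed simp
  then show ?thesis by (simp add: exc_def)
qed

lemma
  assumes \<sigma>: "\<sigma> permutes {1..n}"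
  shows des_eq_card_barred_descents: "des n \<sigma> = card (barred_descents n \<sigma>)"
    and maj_eq_sum_barred_descents: "maj n \<sigma> = \<Sum>(barred_descents n \<sigma>) + exc n \<sigma>"
proof -
  let ?d = "\<lambda>x. of_bool (x \<in> DES n \<sigma>) :: nat" and ?D = "\<lambda>x. of_bool (x \<in> barred_descents n \<sigma>) :: nat"
    and ?e = "\<lambda>x. of_bool (x < \<sigma> x) :: nat"
  note DES = sum_of_bool_lessThan[of "DES n \<sigma>" n]
    and barred = sum_of_bool_lessThan[of "barred_descents n \<sigma>" n]
  have subsets: "DES n \<sigma> \<subseteq> {..<n}" "barred_descents n \<sigma> \<subseteq> {..<n}"
    by (auto simp: DES_def barred_descents_def)
  have zero: "\<sigma> 0 = 0" using permutes_not_in[OF \<sigma>, of 0] by simp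
  have last: "\<sigma> n \<le> n"
    using permutes_in_image[OF \<sigma>, of n] permutes_not_in[OF \<sigma>, of n] by (cases "n \<in> {1..n}") auto
  show "des n \<sigma> = card (barred_descents n \<sigma>)"
    using telescope_exchange[of n ?d ?e ?D, OF descent_exchange[OF \<sigma>]] zero last
    by (simp only: DES(1)[OF subsets(1)] barred(1)[OF subsets(2)] des_def) simp
  have "(\<Sum>x<n. ?e (Suc x)) = (\<Sum>x<Suc n. ?e x)"
    using zero by (simp only: sum.lessThan_Suc_shift) simp
  also have "\<dots> = (\<Sum>x<Suc n. of_bool (x \<in> {i. i < \<sigma> i}))" by simp
  also have "\<dots> = card {i. i < \<sigma> i}"
  proof (rule sum_of_bool_lessThan(1))
    show "{i. i < \<sigma> i} \<subseteq> {..<Suc n}"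
    proof
      fix i assume "i \<in> {i. i < \<sigma> i}"
      then have "i \<in> {1..n}" using permutes_not_in[OF \<sigma>, of i] by force
      then show "i \<in> {..<Suc n}" by simp
    qed
  qed
  finally have "(\<Sum>x<n. ?e (Suc x)) = exc n \<sigma>" by (simp only: exc_eq_card[OF \<sigma>])
  then show "maj n \<sigma> = \<Sum>(barred_descents n \<sigma>) + exc n \<sigma>"
    using telescope_exchange_weighted[of n ?d ?e ?D, OF descent_exchange[OF \<sigma>]] last
    by (simp only: DES(2)[OF subsets(1)] barred(2)[OF subsets(2)] maj_def) simp
qed

section \<open>Cycle types\<close>

lemma cycle_type_inv:
  assumes "\<sigma> permutes {1..n}" shows "cycle_type n (inv \<sigma>) = cycle_type n \<sigma>"
proof -
  have "permutation \<sigma>" using assms by (auto simp: permutation_permutes)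
  then show ?thesis by (simp add: cycle_type_def orbit_inv_eq)
qed

lemma orbits_with_zero:
  assumes \<sigma>: "\<sigma> permutes {1..n}"
  shows "image_mset card (mset_set (orbit \<sigma> ` {..n})) = add_mset 1 (cycle_type n \<sigma>)"
proof -
  have zero: "orbit \<sigma> 0 = {0}"
    using permutes_not_in[OF \<sigma>, of 0] by (simp add: orbit_eq_singleton_iff)
  have "{0} \<notin> orbit \<sigma> ` {1..n}"
  proof
    assume "{0} \<in> orbit \<sigma> ` {1..n}"
    then obtain i where "i \<in> {1..n}" "orbit \<sigma> i = {0}" by auto
    then show False using permutes_orbit_subset[OF \<sigma>, of i] by auto
  qed
  moreover have "{..n} = insert 0 {1..n}" by auto
  ultimately show ?thesis by (simp add: cycle_type_def zero)
qed

lemma cycle_type_conjugate: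
  assumes \<sigma>: "\<sigma> permutes {1..n}" and \<tau>: "\<tau> permutes {1..n}" and w: "w permutes {..n}"
    and conj: "\<And>i. w (\<sigma> i) = \<tau> (w i)"
  shows "cycle_type n \<tau> = cycle_type n \<sigma>"
proof -
  have perm: "permutation \<sigma>" using \<sigma> by (auto simp: permutation_permutes)
  have "orbit \<tau> (w i) = w ` orbit \<sigma> i" for i
    using orbit_inverse[where g' = \<tau> and f = w, OF permutation_self_in_orbit[OF perm]] conj
    by simp
  then have "orbit \<tau> ` w ` {..n} = (`) w ` orbit \<sigma> ` {..n}"
    by (simp add: image_image)
  then have orbits: "orbit \<tau> ` {..n} = (`) w ` orbit \<sigma> ` {..n}"
    by (simp only: permutes_image[OF w])
  have inj: "inj w" using permutes_inj[OF w] .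
  then have "inj_on ((`) w) (orbit \<sigma> ` {..n})" by (auto intro!: inj_onI simp: inj_image_eq_iff)
  then have "image_mset card (mset_set (orbit \<tau> ` {..n}))
      = image_mset (card \<circ> (`) w) (mset_set (orbit \<sigma> ` {..n}))"
    by (simp only: orbits image_mset_mset_set[symmetric] multiset.map_comp)
  also have "card \<circ> (`) w = card"
    using card_image[OF inj_on_subset[OF inj subset_UNIV]] by (simp add: fun_eq_iff)
  finally show ?thesis by (simp add: orbits_with_zero[OF \<sigma>] orbits_with_zero[OF \<tau>])
qed

lemma count_cycle_type_1:
  assumes \<sigma>: "\<sigma> permutes {1..n}"
  shows "count (cycle_type n \<sigma>) 1 = card {i \<in> {1..n}. \<sigma> i = i}"
proof -
  have perm: "permutation \<sigma>" using \<sigma> by (auto simp: permutation_permutes)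
  have "{s \<in> orbit \<sigma> ` {1..n}. 1 = card s} = (\<lambda>i. {i}) ` {i \<in> {1..n}. \<sigma> i = i}"
  proof (intro equalityI subsetI)
    fix s assume "s \<in> {s \<in> orbit \<sigma> ` {1..n}. 1 = card s}"
    then obtain i where i: "i \<in> {1..n}" "s = orbit \<sigma> i" "1 = card s" by blast
    from i(3) obtain j where "s = {j}" by (metis card_1_singletonE)
    then have "s = {i}" using permutation_self_in_orbit[OF perm, of i] i(2) by simp
    moreover from this have "\<sigma> i = i" using i(2) orbit_eq_singleton_iff[of \<sigma> i] by simp
    ultimately show "s \<in> (\<lambda>i. {i}) ` {i \<in> {1..n}. \<sigma> i = i}" using i(1) by blast
  next
    fix s assume "s \<in> (\<lambda>i. {i}) ` {i \<in> {1..n}. \<sigma> i = i}"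
    then obtain i where i: "i \<in> {1..n}" "\<sigma> i = i" "s = {i}" by blast
    then have "s = orbit \<sigma> i" using orbit_eq_singleton_iff[of \<sigma> i] by simp
    moreover have "1 = card s" using i(3) by simp
    ultimately show "s \<in> {s \<in> orbit \<sigma> ` {1..n}. 1 = card s}" using i(1) by blast
  qed
  note singletons = this
  let ?O = "orbit \<sigma> ` {1..n}"
  have "count (cycle_type n \<sigma>) 1
      = (\<Sum>s | s \<in># mset_set ?O \<and> 1 = card s. count (mset_set ?O) s)"
    by (simp only: cycle_type_def count_image_mset')
  also have "\<dots> = (\<Sum>s \<in> {s \<in> ?O. 1 = card s}. 1)" by (intro sum.cong) auto
  also have "\<dots> = card ((\<lambda>i. {i}) ` {i \<in> {1..n}. \<sigma> i = i})"
    by (simp only: singletons card_eq_sum[of "(\<lambda>i. {i}) ` {i \<in> {1..n}. \<sigma> i = i}"])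
  also have "\<dots> = card {i \<in> {1..n}. \<sigma> i = i}" by (intro card_image) simp
  finally show ?thesis .
qed

lemma exc_add_exc_inv:
  assumes \<sigma>: "\<sigma> permutes {1..n}"
  shows "exc n \<sigma> + exc n (inv \<sigma>) + count (cycle_type n \<sigma>) 1 = n"
proof -
  note inverses = permutes_inverses[OF \<sigma>]
  have "{i. i < inv \<sigma> i} = \<sigma> ` {i. \<sigma> i < i}"
  proof (intro equalityI subsetI)
    fix i assume "i \<in> {i. i < inv \<sigma> i}"
    then show "i \<in> \<sigma> ` {i. \<sigma> i < i}"
      by (intro image_eqI[of _ _ "inv \<sigma> i"]) (simp_all add: inverses)
  next
    fix i assume "i \<in> \<sigma> ` {i. \<sigma> i < i}"
    then obtain j where "\<sigma> j < j" "i = \<sigma> j" by blast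
    then show "i \<in> {i. i < inv \<sigma> i}" by (simp add: inverses)
  qed
  then have inv: "card {i. i < inv \<sigma> i} = card {i. \<sigma> i < i}"
    using card_image[OF inj_on_subset[OF permutes_inj[OF \<sigma>] subset_UNIV], of "{i. \<sigma> i < i}"]
    by (simp only:)
  have moved: "i \<in> {1..n}" if "\<sigma> i \<noteq> i" for i using permutes_not_in[OF \<sigma>, of i] that by blast
  have sub: "{i. i < \<sigma> i} \<subseteq> {1..n}" "{i. \<sigma> i < i} \<subseteq> {1..n}"
    by (intro subsetI moved; simp)+
  have fin: "finite {i. i < \<sigma> i}" "finite {i. \<sigma> i < i}"
    using finite_subset[OF sub(1)] finite_subset[OF sub(2)] by simp_all
  have "{1..n} = {i. i < \<sigma> i} \<union> ({i. \<sigma> i < i} \<union> {i \<in> {1..n}. \<sigma> i = i})"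
  proof (intro equalityI subsetI)
    fix i assume "i \<in> {1..n}"
    then show "i \<in> {i. i < \<sigma> i} \<union> ({i. \<sigma> i < i} \<union> {i \<in> {1..n}. \<sigma> i = i})"
      by (cases i "\<sigma> i" rule: linorder_cases) simp_all
  qed (use sub in blast)
  then have "card {1..n} = card ({i. i < \<sigma> i} \<union> ({i. \<sigma> i < i} \<union> {i \<in> {1..n}. \<sigma> i = i}))"
    by (rule arg_cong)
  also have "\<dots> = card {i. i < \<sigma> i} + card ({i. \<sigma> i < i} \<union> {i \<in> {1..n}. \<sigma> i = i})"
    using fin by (intro card_Un_disjoint) auto
  also have "card ({i. \<sigma> i < i} \<union> {i \<in> {1..n}. \<sigma> i = i})
      = card {i. \<sigma> i < i} + card {i \<in> {1..n}. \<sigma> i = i}"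
    using fin by (intro card_Un_disjoint) auto
  finally have "n = card {i. i < \<sigma> i} + (card {i. \<sigma> i < i} + card {i \<in> {1..n}. \<sigma> i = i})"
    by simp
  then show ?thesis
    unfolding exc_eq_card[OF \<sigma>] exc_eq_card[OF permutes_inv[OF \<sigma>]] inv
      count_cycle_type_1[OF \<sigma>] by linarith
qed

lemma permutation_of_cycle_type_exists:
  assumes "is_partition n lam"
  shows "\<exists>\<sigma>. \<sigma> permutes {1..n} \<and> cycle_type n \<sigma> = lam"
  using assms
proof (induction lam arbitrary: n)
  case empty
  then have "n = 0" by (simp add: is_partition_def)
  then have "id permutes {1..n} \<and> cycle_type n id = {#}"
    using permutes_id[of "{1..n}"] by (simp add: cycle_type_def)
  then show ?case by blast
next
  case (add m lam)
  define n' where "n' = \<Sum>\<^sub># lam"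
  have n: "n = n' + m" and m: "m > 0" and "is_partition n' lam"
    using add.prems by (auto simp: is_partition_def n'_def)
  then obtain \<sigma> where \<sigma>: "\<sigma> permutes {1..n'}" "cycle_type n' \<sigma> = lam" using add.IH by blast
  have \<sigma>_in: "\<sigma> i \<in> {1..n'} \<longleftrightarrow> i \<in> {1..n'}" for i using permutes_in_image[OF \<sigma>(1)] .
  \<comment> \<open>The new cycle is \<open>n' + 1 \<mapsto> n' + 2 \<mapsto> ... \<mapsto> n \<mapsto> n' + 1\<close>.\<close>
  define \<tau> where "\<tau> i = (if i \<le> n' then \<sigma> i else if i < n then Suc i else if i = n then Suc n' else i)" for i
  have \<sigma>0: "\<sigma> 0 = 0" using permutes_not_in[OF \<sigma>(1), of 0] by simp
  have \<tau>_in: "\<tau> i \<in> {1..n}" if "i \<in> {1..n}" for i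
    using that \<sigma>_in[of i] n m by (auto simp: \<tau>_def)
  have "inj_on \<tau> {1..n}"
  proof (rule inj_onI)
    fix i j assume ij: "i \<in> {1..n}" "j \<in> {1..n}" "\<tau> i = \<tau> j"
    have old: "\<tau> l \<le> n' \<longleftrightarrow> l \<le> n'" if "l \<in> {1..n}" for l
      using \<sigma>_in[of l] that by (auto simp: \<tau>_def)
    show "i = j"
    proof (cases "i \<le> n'")
      case True
      with old[OF ij(1)] old[OF ij(2)] ij(3) have "\<sigma> i = \<sigma> j" by (simp add: \<tau>_def)
      then show ?thesis using inj_eq[OF permutes_inj[OF \<sigma>(1)]] by simp
    next
      case False
      with old[OF ij(1)] old[OF ij(2)] ij show ?thesis by (auto simp: \<tau>_def split: if_splits)
    qed
  qed
  moreover from this have "\<tau> ` {1..n} = {1..n}"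
    using \<tau>_in by (intro endo_inj_surj) blast+
  ultimately have "bij_betw \<tau> {1..n} {1..n}" by (simp only: bij_betw_def)
  moreover have "\<tau> i = i" if "i \<notin> {1..n}" for i
  proof -
    have "i = 0 \<or> i > n" using that by auto
    then show ?thesis using \<sigma>0 n by (auto simp: \<tau>_def)
  qed
  ultimately have \<tau>: "\<tau> permutes {1..n}" by (rule bij_imp_permutes)
  have old_orbit: "orbit \<tau> i = orbit \<sigma> i" if "i \<in> {1..n'}" for i
    using that \<sigma>_in by (intro orbit_cong0[of _ "{1..n'}"]) (auto simp: \<tau>_def)
  have new: "{Suc n'..n} = orbit \<tau> (Suc n')"
  proof (intro equalityI subsetI)
    have "(\<tau> ^^ k) (Suc n') = Suc (n' + k)" if "k < m" for k
      using that by (induction k) (auto simp: \<tau>_def n)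
    then have pow: "(\<tau> ^^ (i - Suc n')) (Suc n') = i" if "i \<in> {Suc n'..n}" for i
      using that n by auto
    have "(\<tau> ^^ Suc (n - Suc n')) (Suc n') = Suc n'"
    proof -
      have "(\<tau> ^^ Suc (n - Suc n')) (Suc n') = \<tau> n"
        using pow[of n] n m by (simp only: funpow.simps comp_apply) simp
      then show ?thesis using n m by (simp add: \<tau>_def)
    qed
    then have self: "Suc n' \<in> orbit \<tau> (Suc n')"
      unfolding orbit_altdef mem_Collect_eq by (metis zero_less_Suc)
    fix i assume i: "i \<in> {Suc n'..n}"
    show "i \<in> orbit \<tau> (Suc n')"
      unfolding orbit_altdef_self_in[OF self] mem_Collect_eq using pow[OF i] by metis
  next
    fix i assume "i \<in> orbit \<tau> (Suc n')"
    then show "i \<in> {Suc n'..n}"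
      by induction (use n m in \<open>auto simp: \<tau>_def\<close>)
  qed
  have "cyclic_on \<tau> {Suc n'..n}"
    by (rule cyclic_on_singleI[OF _ new]) (use n m in simp)
  then have new_orbit: "orbit \<tau> i = {Suc n'..n}" if "i \<in> {Suc n'..n}" for i
    using that by (rule orbit_cyclic_eq3)
  have "{1..n} = {1..n'} \<union> {Suc n'..n}" using n by auto
  then have "orbit \<tau> ` {1..n} = orbit \<tau> ` {1..n'} \<union> orbit \<tau> ` {Suc n'..n}"
    by (simp only: image_Un)
  moreover have "orbit \<tau> ` {1..n'} = orbit \<sigma> ` {1..n'}"
    by (intro image_cong refl old_orbit)
  moreover have "orbit \<tau> ` {Suc n'..n} = (\<lambda>_. {Suc n'..n}) ` {Suc n'..n}"
    by (intro image_cong refl new_orbit)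
  moreover have "{Suc n'..n} \<noteq> {}" using n m by simp
  ultimately have "orbit \<tau> ` {1..n} = insert {Suc n'..n} (orbit \<sigma> ` {1..n'})"
    by (simp only: image_constant_conv) simp
  moreover have "{Suc n'..n} \<notin> orbit \<sigma> ` {1..n'}"
  proof
    assume "{Suc n'..n} \<in> orbit \<sigma> ` {1..n'}"
    then obtain i where "i \<in> {1..n'}" "{Suc n'..n} = orbit \<sigma> i" by blast
    then have "{Suc n'..n} \<subseteq> {1..n'}" using permutes_orbit_subset[OF \<sigma>(1)] by metis
    moreover have "n \<in> {Suc n'..n}" using n m by simp
    ultimately have "n \<in> {1..n'}" by blast
    then show False using n m by simp
  qed
  ultimately have "cycle_type n \<tau> = add_mset m lam"
    using \<sigma>(2) n by (simp add: cycle_type_def)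
  with \<tau> show ?case by blast
qed

section \<open>Symmetric distribution of the barred descent set\<close>

context
  fixes n :: nat and lam :: "nat multiset"
begin

definition class_with_descents_in :: "nat set \<Rightarrow> nat \<Rightarrow> (nat \<Rightarrow> nat) set" where
  "class_with_descents_in S j =
    {\<sigma>. \<sigma> permutes {1..n} \<and> cycle_type n \<sigma> = lam \<and> exc n \<sigma> = j \<and> barred_descents n \<sigma> \<subseteq> S}"

definition class_with_descents :: "nat set \<Rightarrow> nat \<Rightarrow> (nat \<Rightarrow> nat) set" where
  "class_with_descents S j =
    {\<sigma>. \<sigma> permutes {1..n} \<and> cycle_type n \<sigma> = lam \<and> exc n \<sigma> = j \<and> barred_descents n \<sigma> = S}"

lemma finite_class_with_descents: "finite (class_with_descents S j)"
  by (rule finite_subset[OF _ finite_permutations[of "{1..n}"]])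
    (auto simp: class_with_descents_def)

lemma finite_class_with_descents_in: "finite (class_with_descents_in S j)"
  by (rule finite_subset[OF _ finite_permutations[of "{1..n}"]])
    (auto simp: class_with_descents_in_def)

text \<open>
  Block 0 contains the artificial fixed point 0, and in a compatible permutation it then consists of
  fixed points: there are no excedances left, and the values increase.
\<close>

lemma compatible_fixes_block_0:
  assumes comp: "compatible b n \<sigma>" and b: "mono b" "b 0 = 0"
    and zero: "\<sigma> 0 = 0" and i: "i \<le> n" "b i = 0"
  shows "\<sigma> i = i"
proof (cases "i = 0")
  case True
  then show ?thesis using zero by simp
next
  case False
  have block: "b j = 0" if "j \<le> i" for j using monoD[OF b(1) that] i(2) by simp
  have small: "\<sigma> j \<le> j" if "j \<le> i" for j
    using compatible_less[OF comp, of 0 j] that i(1) block[OF that] b(2) zero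
    by (cases "j = 0") (auto simp: letter_def split: if_splits)
  have "j \<le> \<sigma> j" if "j \<le> i" for j
    using that
  proof (induction j)
    case (Suc j)
    have "letter b \<sigma> j = letter b \<sigma> (Suc j)"
      using small[of j] small[of "Suc j"] block[of j] block[of "Suc j"] Suc.prems
      by (simp add: letter_eq_iff)
    then have "\<sigma> j < \<sigma> (Suc j)"
      using compatible_less[OF comp, of j "Suc j"] Suc.prems i(1) by simp
    then show ?case using Suc by simp
  qed simp
  then show ?thesis using small[of i] by (simp add: order_antisym)
qed

text \<open>
  Sorting the inverse within the blocks is the reversal of all arcs of the necklaces; it exchanges
  excedances and anti-excedances, and it is injective because the class of a compatible permutation
  determines it.
\<close>

lemma card_class_with_descents_in_le:
  assumes S: "S \<subseteq> {..<n}"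
  shows "card (class_with_descents_in S j) \<le> card (class_with_descents_in S (n - count lam 1 - j))"
proof -
  have fin: "finite S" using S by (rule finite_subset) simp
  define b where "b = block_number S"
  have b: "mono b" "b 0 = 0" and b_le: "\<And>i. b i \<le> card S"
    using fin by (simp_all add: b_def block_number_mono block_number_0 block_number_le)
  define reverse where
    "reverse \<sigma> = (SOME \<tau>. compatible b n \<tau> \<and> block_conjugate b n (inv \<sigma>) \<tau>)" for \<sigma>
  have comp: "compatible b n \<sigma>" if "\<sigma> \<in> class_with_descents_in S j" for \<sigma> j
    using that compatible_iff_barred_descents_subset[OF permutes_subset[of \<sigma> "{1..n}"] fin]
    by (auto simp: class_with_descents_in_def b_def)
  have reverse: "compatible b n (reverse \<sigma>)" "block_conjugate b n (inv \<sigma>) (reverse \<sigma>)"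
    if "\<sigma> \<in> class_with_descents_in S j" for \<sigma> j
    using someI_ex[OF compatible_conjugate_of_inverse_exists[OF b(1) b_le comp[OF that]]]
    by (simp_all add: reverse_def)
  show ?thesis
  proof (rule card_inj_on_le[OF _ _ finite_class_with_descents_in])
    show "inj_on reverse (class_with_descents_in S j)"
    proof (rule inj_onI)
      fix \<sigma> \<tau>
      assume \<sigma>: "\<sigma> \<in> class_with_descents_in S j" and \<tau>: "\<tau> \<in> class_with_descents_in S j"
        and "reverse \<sigma> = reverse \<tau>"
      then have conj: "block_conjugate b n (inv \<sigma>) (inv \<tau>)"
        using reverse(2) block_conjugate_sym block_conjugate_trans by metis
      note perms = compatible_permutes[OF comp[OF \<sigma>]] compatible_permutes[OF comp[OF \<tau>]]
      have "block_conjugate b n \<sigma> \<tau>"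
        using block_conjugate_inv[OF conj permutes_inv[OF perms(1)] permutes_inv[OF perms(2)]]
        by (simp add: permutes_inv_inv[OF perms(1)] permutes_inv_inv[OF perms(2)])
      then show "\<sigma> = \<tau>"
        using compatible_unique[OF b(1) b_le comp[OF \<sigma>] comp[OF \<tau>]] by blast
    qed
    show "reverse ` class_with_descents_in S j
        \<subseteq> class_with_descents_in S (n - count lam 1 - j)"
    proof (rule image_subsetI)
      fix \<sigma> assume \<sigma>: "\<sigma> \<in> class_with_descents_in S j"
      then have \<sigma>p: "\<sigma> permutes {1..n}" and type: "cycle_type n \<sigma> = lam" and exc: "exc n \<sigma> = j"
        by (simp_all add: class_with_descents_in_def)
      define \<tau> where "\<tau> = reverse \<sigma>"
      have \<tau>: "compatible b n \<tau>" using reverse(1)[OF \<sigma>] by (simp add: \<tau>_def)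
      obtain w where w: "w permutes {..n}" "\<And>i. b (w i) = b i" "\<And>i. w (inv \<sigma> i) = \<tau> (w i)"
          "\<And>i. i < inv \<sigma> i \<longleftrightarrow> w i < \<tau> (w i)"
        using reverse(2)[OF \<sigma>] unfolding block_conjugate_def \<tau>_def by blast
      have "\<tau> 0 = 0"
      proof -
        define z where "z = inv w 0"
        have wz: "w z = 0" by (simp add: z_def permutes_inverses[OF w(1)])
        then have "b z = 0" using w(2)[of z] b(2) by simp
        moreover have "z \<le> n" using permutes_in_image[OF w(1), of z] wz by simp
        moreover have "\<sigma> 0 = 0" using permutes_not_in[OF \<sigma>p, of 0] by simp
        ultimately have "\<sigma> z = z" using compatible_fixes_block_0[OF comp[OF \<sigma>] b] by blast
        then have "inv \<sigma> z = z" by (metis permutes_inverses(2)[OF \<sigma>p])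
        then show ?thesis using w(3)[of z] wz by simp
      qed
      then have \<tau>p: "\<tau> permutes {1..n}"
        by (intro permutes_superset[OF compatible_permutes[OF \<tau>]]) (auto simp: not_le Suc_le_eq)
      have "cycle_type n \<tau> = lam"
        using cycle_type_conjugate[OF permutes_inv[OF \<sigma>p] \<tau>p w(1,3)] cycle_type_inv[OF \<sigma>p] type
        by simp
      moreover have "exc n \<tau> = n - count lam 1 - j"
      proof -
        have "{i. i < \<tau> i} = w ` {i. i < inv \<sigma> i}"
        proof (intro equalityI subsetI)
          fix i assume "i \<in> {i. i < \<tau> i}"
          then show "i \<in> w ` {i. i < inv \<sigma> i}"
            using w(4)[of "inv w i"]
            by (intro image_eqI[of _ _ "inv w i"]) (simp_all add: permutes_inverses[OF w(1)])
        next
          fix i assume "i \<in> w ` {i. i < inv \<sigma> i}"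
          then show "i \<in> {i. i < \<tau> i}" using w(4) by blast
        qed
        then have "card {i. i < \<tau> i} = card {i. i < inv \<sigma> i}"
          using card_image[OF inj_on_subset[OF permutes_inj[OF w(1)] subset_UNIV],
              of "{i. i < inv \<sigma> i}"] by (simp only:)
        then have "exc n \<tau> = exc n (inv \<sigma>)"
          by (simp only: exc_eq_card[OF \<tau>p] exc_eq_card[OF permutes_inv[OF \<sigma>p]])
        then show ?thesis using exc_add_exc_inv[OF \<sigma>p] type exc by simp
      qed
      moreover have "barred_descents n \<tau> \<subseteq> S"
        using compatible_iff_barred_descents_subset[OF compatible_permutes[OF \<tau>] fin] \<tau>
        by (simp add: b_def)
      ultimately show "reverse \<sigma> \<in> class_with_descents_in S (n - count lam 1 - j)"
        using \<tau>p by (simp add: class_with_descents_in_def \<tau>_def[symmetric])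
    qed
  qed
qed

lemma card_class_with_descents_in_symmetric:
  assumes "S \<subseteq> {..<n}" "j \<le> n - count lam 1"
  shows "card (class_with_descents_in S j) = card (class_with_descents_in S (n - count lam 1 - j))"
proof (rule antisym[OF card_class_with_descents_in_le[OF assms(1)]])
  have "n - count lam 1 - (n - count lam 1 - j) = j" using assms(2) by simp
  then show "card (class_with_descents_in S (n - count lam 1 - j))
      \<le> card (class_with_descents_in S j)"
    using card_class_with_descents_in_le[OF assms(1), of "n - count lam 1 - j"] by (simp only:)
qed

lemma card_class_with_descents_in_eq_sum:
  assumes "finite S"
  shows "card (class_with_descents_in S j) = (\<Sum>T\<in>Pow S. card (class_with_descents T j))"
proof -
  have "class_with_descents_in S j = (\<Union>T\<in>Pow S. class_with_descents T j)"
    by (auto simp: class_with_descents_in_def class_with_descents_def)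
  moreover have "card (\<Union>T\<in>Pow S. class_with_descents T j)
      = (\<Sum>T\<in>Pow S. card (class_with_descents T j))"
    by (rule card_UN_disjoint)
      (use assms finite_class_with_descents in \<open>auto simp: class_with_descents_def\<close>)
  ultimately show ?thesis by simp
qed

text \<open>Inclusion-exclusion over subsets of \<open>S\<close>, as an induction on \<open>S\<close>.\<close>

lemma card_class_with_descents_symmetric:
  assumes "S \<subseteq> {..<n}" and j: "j \<le> n - count lam 1"
  shows "card (class_with_descents S j) = card (class_with_descents S (n - count lam 1 - j))"
proof -
  have "finite S" using assms(1) by (rule finite_subset) simp
  then show ?thesis
    using assms(1)
  proof (induction S rule: finite_psubset_induct)
    case (psubset S)
    have Pow: "Pow S = insert S {T. T \<subset> S}" by auto
    have fin: "finite {T. T \<subset> S}" using psubset.hyps by (rule finite_subset[OF _ finite_Pow_iff[THEN iffD2], rotated]) auto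
    have split: "card (class_with_descents_in S i)
        = card (class_with_descents S i) + (\<Sum>T | T \<subset> S. card (class_with_descents T i))" for i
      unfolding card_class_with_descents_in_eq_sum[OF psubset.hyps(1)] Pow using fin by simp
    have "(\<Sum>T | T \<subset> S. card (class_with_descents T j))
        = (\<Sum>T | T \<subset> S. card (class_with_descents T (n - count lam 1 - j)))"
      using psubset by (intro sum.cong) auto
    then show ?case
      using split[of j] split[of "n - count lam 1 - j"]
        card_class_with_descents_in_symmetric[OF psubset.prems j] by simp
  qed
qed

end

section \<open>Coefficients of the shifted polynomial\<close>

definition shifted_polynomial :: "nat \<Rightarrow> nat multiset \<Rightarrow> int poly poly poly" where
  "shifted_polynomial n lam =
    (\<Sum>\<sigma> | \<sigma> permutes {1..n} \<and> cycle_type n \<sigma> = lam.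
      monom (q_ind ^ \<Sum>(barred_descents n \<sigma>) * p_ind ^ card (barred_descents n \<sigma>)) (exc n \<sigma>))"

lemma finite_cycle_class: "finite {\<sigma>. \<sigma> permutes {1..n} \<and> cycle_type n \<sigma> = lam}"
  by (rule finite_subset[OF _ finite_permutations[of "{1..n}"]]) auto

lemma to_fract_power: "to_fract (x ^ k) = to_fract x ^ k"
  by (induction k) simp_all

lemma const_poly_power: "[:c:] ^ k = [:c ^ k:]" for c :: "'a :: comm_semiring_1"
  by (induction k) (simp_all add: one_pCons mult.commute)

text \<open>
  The factor \<open>q\<close> to the power \<open>- exc\<close> cancels against the excess of \<open>maj\<close> over the sum of the
  barred descents.
\<close>

lemma map_poly_shifted_polynomial:
  "map_poly to_fract (shifted_polynomial n lam) = A_poly_shifted n lam"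
proof -
  let ?A = "{\<sigma>. \<sigma> permutes {1..n} \<and> cycle_type n \<sigma> = lam}"
  define q p where "q = to_fract q_ind" and "p = to_fract p_ind"
  have q: "q \<noteq> 0" by (simp add: q_def q_ind_def)
  let ?c = "\<lambda>\<sigma>. q_ind ^ \<Sum>(barred_descents n \<sigma>) * p_ind ^ card (barred_descents n \<sigma>)"
  have "map_poly to_fract (shifted_polynomial n lam)
      = (\<Sum>\<sigma>\<in>?A. monom (to_fract (?c \<sigma>)) (exc n \<sigma>))"
    by (rule poly_eqI)
      (simp add: shifted_polynomial_def coeff_map_poly coeff_sum if_distrib cong: if_cong)
  also have "\<dots> = (\<Sum>\<sigma>\<in>?A. [:q:] ^ maj n \<sigma> * [:p:] ^ des n \<sigma> * ([:inverse q:] * [:0, 1:]) ^ exc n \<sigma>)"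
  proof (rule sum.cong[OF refl])
    fix \<sigma> assume "\<sigma> \<in> ?A"
    then have \<sigma>: "\<sigma> permutes {1..n}" by simp
    have "[:inverse q:] * [:0, 1:] = monom (inverse q) 1" by (simp add: monom_altdef)
    then have "([:inverse q:] * [:0, 1:]) ^ exc n \<sigma> = monom (inverse q ^ exc n \<sigma>) (exc n \<sigma>)"
      by (simp add: monom_power)
    then have "[:q:] ^ maj n \<sigma> * [:p:] ^ des n \<sigma> * ([:inverse q:] * [:0, 1:]) ^ exc n \<sigma>
        = monom (q ^ maj n \<sigma> * p ^ des n \<sigma> * inverse q ^ exc n \<sigma>) (exc n \<sigma>)"
      by (simp add: const_poly_power smult_monom mult.assoc)
    also have "q ^ maj n \<sigma> * p ^ des n \<sigma> * inverse q ^ exc n \<sigma> = to_fract (?c \<sigma>)"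
      using q by (simp add: maj_eq_sum_barred_descents[OF \<sigma>] des_eq_card_barred_descents[OF \<sigma>]
          power_add to_fract_power q_def p_def field_simps)
    finally show "monom (to_fract (?c \<sigma>)) (exc n \<sigma>)
        = [:q:] ^ maj n \<sigma> * [:p:] ^ des n \<sigma> * ([:inverse q:] * [:0, 1:]) ^ exc n \<sigma>" ..
  qed
  also have "\<dots> = A_poly_shifted n lam"
    by (simp only: A_poly_shifted_def A_poly_def Let_def q_def p_def)
  finally show ?thesis .
qed

lemma coeff_shifted_polynomial:
  "coeff (shifted_polynomial n lam) j
    = (\<Sum>S\<in>Pow {..<n}. of_nat (card (class_with_descents n lam S j)) * (q_ind ^ \<Sum>S * p_ind ^ card S))"
proof -
  let ?A = "{\<sigma>. \<sigma> permutes {1..n} \<and> cycle_type n \<sigma> = lam}"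
  let ?g = "\<lambda>S. q_ind ^ \<Sum>S * p_ind ^ card S :: int poly poly"
  have "coeff (shifted_polynomial n lam) j
      = (\<Sum>\<sigma>\<in>?A. if exc n \<sigma> = j then ?g (barred_descents n \<sigma>) else 0)"
    by (simp add: shifted_polynomial_def coeff_sum)
  also have "\<dots> = (\<Sum>\<sigma>\<in>{\<sigma> \<in> ?A. exc n \<sigma> = j}. ?g (barred_descents n \<sigma>))"
    by (rule sum.inter_filter[symmetric, OF finite_cycle_class])
  also have "\<dots> = (\<Sum>S\<in>Pow {..<n}. \<Sum>\<sigma> | \<sigma> \<in> {\<sigma> \<in> ?A. exc n \<sigma> = j} \<and> barred_descents n \<sigma> = S.
      ?g (barred_descents n \<sigma>))"
  proof (rule sum.group[symmetric])
    show "finite {\<sigma> \<in> ?A. exc n \<sigma> = j}"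
      by (rule finite_subset[OF _ finite_cycle_class[of n lam]]) auto
  qed (auto simp: barred_descents_def)
  also have "\<dots> = (\<Sum>S\<in>Pow {..<n}. \<Sum>\<sigma>\<in>class_with_descents n lam S j. ?g S)"
    by (intro sum.cong refl) (auto simp: class_with_descents_def)
  finally show ?thesis by simp
qed

text \<open>
  The reflection \<open>j \<mapsto> N - j\<close> exchanges the lowest and the highest exponent, so their sum is \<open>N\<close> even
  when neither is \<open>0\<close> or \<open>N\<close>.
\<close>

lemma t_symmetric_if_coeffs_symmetric:
  fixes f :: "'a :: comm_ring_1 poly"
  assumes "f \<noteq> 0" and sym: "\<And>j. j \<le> N \<Longrightarrow> coeff f j = coeff f (N - j)"
    and high: "\<And>j. j > N \<Longrightarrow> coeff f j = 0"
  shows "t_symmetric f (real N / 2)"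
proof -
  define s where "s = degree f"
  define r where "r = (LEAST j. coeff f j \<noteq> 0)"
  have s: "coeff f s \<noteq> 0" using assms(1) by (simp add: s_def)
  then have r: "coeff f r \<noteq> 0" unfolding r_def by (rule LeastI)
  have le: "j \<le> N" "r \<le> j" "j \<le> s" if "coeff f j \<noteq> 0" for j
    using that high[of j] by (metis not_le, simp_all add: r_def s_def Least_le le_degree)
  have "r \<le> N - s" using le(2)[of "N - s"] sym[of s] s le(1)[OF s] by simp
  moreover have "N - r \<le> s" using le(3)[of "N - r"] sym[of r] r le(1)[OF r] by simp
  ultimately have N: "r + s = N" using le(1)[OF r] le(1)[OF s] by simp
  have "f = (\<Sum>i = r..s. monom (coeff f i) i)"
  proof (rule poly_eqI)
    fix j
    show "coeff f j = coeff (\<Sum>i = r..s. monom (coeff f i) i) j"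
      using le(2,3)[of j] by (cases "j \<in> {r..s}") (auto simp: coeff_sum)
  qed
  moreover have "coeff f (r + i) = coeff f (s - i)" if "i \<in> {0..s - r}" for i
  proof -
    have "r + i \<le> N" "N - (r + i) = s - i" using that N le(2)[OF s] by auto
    then show ?thesis using sym[of "r + i"] by simp
  qed
  moreover have "real N / 2 = (real s + real r) / 2" using N by auto
  ultimately show ?thesis
    unfolding t_symmetric_def using assms(1) r s le(2)[OF s] by blast
qed

theorem theorem5p13:
  fixes n k :: nat and lam :: "nat multiset"
  assumes "n \<ge> 1"
    and "is_partition n lam"
    and "count lam 1 = k"
  shows "\<exists>f :: int poly poly poly.
    map_poly to_fract f = A_poly_shifted n lam \<and> t_symmetric f ((real n - real k) / 2)"
proof (intro exI conjI)
  let ?f = "shifted_polynomial n lam"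
  show "map_poly to_fract ?f = A_poly_shifted n lam" by (rule map_poly_shifted_polynomial)
  obtain \<sigma> where \<sigma>: "\<sigma> permutes {1..n}" "cycle_type n \<sigma> = lam"
    using permutation_of_cycle_type_exists[OF assms(2)] by blast
  have "k \<le> n" using exc_add_exc_inv[OF \<sigma>(1)] \<sigma>(2) assms(3) by simp
  have sym: "coeff ?f j = coeff ?f (n - k - j)" if "j \<le> n - k" for j
    unfolding coeff_shifted_polynomial
    using card_class_with_descents_symmetric[of _ n j lam] that assms(3)
    by (intro sum.cong refl) auto
  have high: "coeff ?f j = 0" if "j > n - k" for j
  proof -
    have "class_with_descents n lam S j = {}" for S
      using that exc_add_exc_inv[of _ n] assms(3) by (fastforce simp: class_with_descents_def)
    then show ?thesis by (simp add: coeff_shifted_polynomial)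
  qed
  \<comment> \<open>At \<open>q = p = 1\<close> the coefficients become numbers of permutations, so nothing cancels.\<close>
  define j where "j = exc n \<sigma>"
  have "poly (poly (coeff ?f j) 1) 1
      = (\<Sum>S\<in>Pow {..<n}. int (card (class_with_descents n lam S j)))"
    by (simp add: coeff_shifted_polynomial poly_sum q_ind_def p_ind_def)
  also have "\<dots> \<ge> int (card (class_with_descents n lam (barred_descents n \<sigma>) j))"
    by (rule member_le_sum) (auto simp: barred_descents_def)
  moreover have "card (class_with_descents n lam (barred_descents n \<sigma>) j) > 0"
    using \<sigma> finite_class_with_descents[of n lam]
    by (auto simp: card_gt_0_iff class_with_descents_def j_def)
  ultimately have "poly (poly (coeff ?f j) 1) 1 > 0" by linarith
  then have "?f \<noteq> 0" by auto
  from t_symmetric_if_coeffs_symmetric[OF this sym high]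
  show "t_symmetric ?f ((real n - real k) / 2)" using \<open>k \<le> n\<close> by (simp add: of_nat_diff)
qed

end
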